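(* Let $M=(M^2,\varphi)$ be a two-dimensional Finsler manifold whose metric is second-order flat at a point $p\in M$. Let $V=(V^3,\Phi)$ be a $3$-dimensional Banach-Minkowski space and $f\colon M\to V$ a smooth isometric embedding. Then the second fundamental form of $f$ at $p$ is degenerate.
   Context: "Smooth" means $C^\infty$. A norm on a real vector space $V$ is a subadditive, positively homogeneous function $\Phi\colon V\to[0,\infty)$, positive on $V\setminus\{0\}$, not required to be symmetric. A Banach-Minkowski norm is a norm that is smooth on $V\setminus\{0\}$ and such that $\Phi^2$ is quadratically strictly convex (second differential positive definite at every $v\neq0$). A Banach-Minkowski space is a finite-dimensional vector space with a Banach-Minkowski norm; it is naturally a Finsler manifold. A Finsler manifold $(M,\varphi)$ is a smooth manifold with a continuous $\varphi\colon TM\to[0,\infty)$, smooth on $TM$ minus the zero section, whose restriction to each $T_xM$ is a Banach-Minkowski norm; we write $\varphi(x,v)$ for $v\in T_xM$. A smooth embedding $f\colon M\to V$ is isometric if $\Phi(d_xf(v))=\varphi(x,v)$ for all $x\in M$, $v\in T_xM$. A Finsler metric is flat if it is locally isometric to a Banach-Minkowski space. The metric $\varphi$ is second-order flat at $p\in M$ if there is a flat Finsler metric $\varphi_0$ defined in a neighborhood of $p$ such that for $x\in M$ near $p$ and $v\in T_xM\setminus\{0\}$ one has $$\frac{\varphi(x,v)}{\varphi_0(x,v)}=1+o(|x-p|^2),\qquad x\to p$$ (uniformly in $v$), where $|x-p|$ is the distance from $x$ to $p$ in an arbitrary local coordinate system. The second fundamental form of a smooth immersion $f\colon M\to V$ at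 $p$ is the symmetric bilinear form on $T_pM$ with values in $V/\operatorname{Im}d_pf$ defined as the Hessian at $p$ of $\pi\circ f$, where $\pi\colon V\to V/\operatorname{Im}d_pf$ is the quotient map. Here the quotient is one-dimensional and the form is regarded as real-valued up to a nonzero constant factor. It is degenerate if it has a nontrivial kernel (the zero form is degenerate). *)

theory Defs
  imports "HOL-Analysis.Analysis"
begin

section \<open>Smooth functions on open subsets of normed spaces\<close>

text \<open>
  Only used for open sets of finite-dimensional spaces, where continuity of all iterated
  directional derivatives is the same as being of class \<open>C\<^sup>n\<close>.
\<close>

primrec C_diff_on ::
    "nat \<Rightarrow> 'a::real_normed_vector set \<Rightarrow> ('a \<Rightarrow> 'b::real_normed_vector) \<Rightarrow> bool" where
  "C_diff_on 0 S f \<longleftrightarrow> continuous_on S f"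
| "C_diff_on (Suc n) S f \<longleftrightarrow>
     (\<forall>x\<in>S. f differentiable (at x)) \<and>
     (\<forall>v. C_diff_on n S (\<lambda>x. frechet_derivative f (at x) v))"

definition smooth_on ::
    "'a::real_normed_vector set \<Rightarrow> ('a \<Rightarrow> 'b::real_normed_vector) \<Rightarrow> bool" where
  "smooth_on S f \<longleftrightarrow> (\<forall>n. C_diff_on n S f)"

definition second_derivative ::
    "('a::real_normed_vector \<Rightarrow> 'b::real_normed_vector) \<Rightarrow> 'a \<Rightarrow> 'a \<Rightarrow> 'a \<Rightarrow> 'b" where
  "second_derivative f x u w =
     frechet_derivative (\<lambda>y. frechet_derivative f (at y) w) (at x) u"

section \<open>Banach-Minkowski norms\<close>

text \<open>Norms are only positively homogeneous; symmetry is not required.\<close>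

definition minkowski_norm :: "('v::real_vector \<Rightarrow> real) \<Rightarrow> bool" where
  "minkowski_norm \<Phi> \<longleftrightarrow>
     (\<forall>x. 0 \<le> \<Phi> x) \<and> (\<forall>x. x \<noteq> 0 \<longrightarrow> 0 < \<Phi> x) \<and>
     (\<forall>x y. \<Phi> (x + y) \<le> \<Phi> x + \<Phi> y) \<and>
     (\<forall>t x. 0 \<le> t \<longrightarrow> \<Phi> (t *\<^sub>R x) = t * \<Phi> x)"

definition banach_minkowski_norm :: "('v::euclidean_space \<Rightarrow> real) \<Rightarrow> bool" where
  "banach_minkowski_norm \<Phi> \<longleftrightarrow>
     minkowski_norm \<Phi> \<and> smooth_on (UNIV - {0}) \<Phi> \<and>
     (\<forall>v w. v \<noteq> 0 \<longrightarrow> w \<noteq> 0 \<longrightarrow> 0 < second_derivative (\<lambda>x. (\<Phi> x)\<^sup>2) v w w)"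

section \<open>Smooth manifolds\<close>

text \<open>A chart is a pair of a domain and a coordinate map, the latter relevant on the domain only.\<close>

type_synonym ('a, 'e) chart = "'a set \<times> ('a \<Rightarrow> 'e)"

definition is_chart :: "'a topology \<Rightarrow> ('a, 'e::euclidean_space) chart \<Rightarrow> bool" where
  "is_chart X c \<longleftrightarrow>
     openin X (fst c) \<and> open (snd c ` fst c) \<and>
     homeomorphic_map (subtopology X (fst c)) (top_of_set (snd c ` fst c)) (snd c)"

definition chart_inv :: "('a, 'e) chart \<Rightarrow> 'e \<Rightarrow> 'a" where
  "chart_inv c = inv_into (fst c) (snd c)"

definition smooth_transition ::
    "('a, 'e::euclidean_space) chart \<Rightarrow> ('a, 'e) chart \<Rightarrow> bool" where
  "smooth_transition c d \<longleftrightarrow>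
     smooth_on (snd c ` (fst c \<inter> fst d)) (snd d \<circ> chart_inv c)"

text \<open>The atlas need not be maximal; the dimension of the manifold is that of \<^typ>\<open>'e\<close>.\<close>

definition smooth_manifold ::
    "'a topology \<Rightarrow> ('a, 'e::euclidean_space) chart set \<Rightarrow> bool" where
  "smooth_manifold X A \<longleftrightarrow>
     Hausdorff_space X \<and> second_countable X \<and>
     (\<forall>c\<in>A. is_chart X c) \<and> (\<Union>c\<in>A. fst c) = topspace X \<and>
     (\<forall>c\<in>A. \<forall>d\<in>A. smooth_transition c d)"

definition charts_at :: "('a, 'e) chart set \<Rightarrow> 'a \<Rightarrow> ('a, 'e) chart set" where
  "charts_at A x = {c \<in> A. x \<in> fst c}"

section \<open>Tangent vectors and differentials\<close>

text \<open>
  A tangent vector at \<open>x\<close> is the family of its coordinate representations in all charts of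
  the atlas around \<open>x\<close>, subject to the usual transformation law. The value is fixed to be \<open>0\<close> at
  charts not around \<open>x\<close>, so that equality of tangent vectors is equality of functions
  and the zero vector is the constant \<open>0\<close>.
\<close>

type_synonym ('a, 'e) tangent_vector = "('a, 'e) chart \<Rightarrow> 'e"

definition tangent_space ::
    "('a, 'e::euclidean_space) chart set \<Rightarrow> 'a \<Rightarrow> ('a, 'e) tangent_vector set" where
  "tangent_space A x =
     {v. (\<forall>c. c \<notin> charts_at A x \<longrightarrow> v c = 0) \<and>
         (\<forall>c \<in> charts_at A x. \<forall>d \<in> charts_at A x.
            v d = frechet_derivative (snd d \<circ> chart_inv c) (at (snd c x)) (v c))}"

abbreviation zero_tangent :: "('a, 'e::euclidean_space) tangent_vector" where
  "zero_tangent \<equiv> (\<lambda>_. 0)"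

text \<open>The tangent vector at \<open>x\<close> whose representation in the chart \<open>c\<close> is \<open>u\<close>.\<close>

definition tangent_of ::
    "('a, 'e::euclidean_space) chart set \<Rightarrow> ('a, 'e) chart \<Rightarrow> 'a \<Rightarrow> 'e \<Rightarrow> ('a, 'e) tangent_vector" where
  "tangent_of A c x u =
     (\<lambda>d. if d \<in> charts_at A x
          then frechet_derivative (snd d \<circ> chart_inv c) (at (snd c x)) u else 0)"

definition smooth_map ::
    "('a, 'e::euclidean_space) chart set \<Rightarrow> ('a \<Rightarrow> 'v::euclidean_space) \<Rightarrow> bool" where
  "smooth_map A f \<longleftrightarrow> (\<forall>c\<in>A. smooth_on (snd c ` fst c) (f \<circ> chart_inv c))"

text \<open>
  The choice of the chart is immaterial by the chain rule. Only the values of \<open>f\<close> near \<open>x\<close>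
  matter, so this also applies to maps defined on an open subset.
\<close>

definition differential ::
    "('a, 'e::euclidean_space) chart set \<Rightarrow> ('a \<Rightarrow> 'v::euclidean_space)
       \<Rightarrow> 'a \<Rightarrow> ('a, 'e) tangent_vector \<Rightarrow> 'v" where
  "differential A f x v =
     (let c = (SOME c. c \<in> charts_at A x)
      in frechet_derivative (f \<circ> chart_inv c) (at (snd c x)) (v c))"

definition smooth_embedding ::
    "'a topology \<Rightarrow> ('a, 'e::euclidean_space) chart set \<Rightarrow> ('a \<Rightarrow> 'v::euclidean_space) \<Rightarrow> bool" where
  "smooth_embedding X A f \<longleftrightarrow>
     smooth_map A f \<and>
     (\<forall>x\<in>topspace X. inj_on (differential A f x) (tangent_space A x)) \<and>
     embedding_map X euclidean f"

section \<open>Finsler metrics\<close>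

text \<open>
  A Finsler metric on the open set \<open>U\<close>. The charts of the tangent bundle send a tangent vector
  \<open>v\<close> at \<open>x\<close> to \<open>(snd c x, v c)\<close>; continuity, smoothness and the linear structure of the fibres
  are expressed in these.
\<close>

definition finsler_metric_on ::
    "'a topology \<Rightarrow> ('a, 'e::euclidean_space) chart set \<Rightarrow> 'a set
       \<Rightarrow> ('a \<Rightarrow> ('a, 'e) tangent_vector \<Rightarrow> real) \<Rightarrow> bool" where
  "finsler_metric_on X A U \<phi> \<longleftrightarrow>
     openin X U \<and>
     (\<forall>c\<in>A.
        let \<phi>c = (\<lambda>(y, u). \<phi> (chart_inv c y) (tangent_of A c (chart_inv c y) u)) in
        continuous_on ((snd c ` (fst c \<inter> U)) \<times> UNIV) \<phi>c \<and>
        smooth_on ((snd c ` (fst c \<inter> U)) \<times> (UNIV - {0})) \<phi>c) \<and>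
     (\<forall>c\<in>A. \<forall>x \<in> fst c \<inter> U. banach_minkowski_norm (\<lambda>u. \<phi> x (tangent_of A c x u)))"

definition isometric_on ::
    "('a, 'e::euclidean_space) chart set \<Rightarrow> 'a set \<Rightarrow> ('a \<Rightarrow> ('a, 'e) tangent_vector \<Rightarrow> real)
       \<Rightarrow> ('a \<Rightarrow> 'v::euclidean_space) \<Rightarrow> ('v \<Rightarrow> real) \<Rightarrow> bool" where
  "isometric_on A U \<phi> f \<Phi> \<longleftrightarrow>
     (\<forall>x\<in>U. \<forall>v\<in>tangent_space A x. \<Phi> (differential A f x v) = \<phi> x v)"

text \<open>
  A local isometry to a Banach-Minkowski space of the same dimension is a chart of the smooth
  structure, taken as a diffeomorphism onto an open subset of the model space with a norm \<open>N\<close>.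
\<close>

definition flat_metric_on ::
    "'a topology \<Rightarrow> ('a, 'e::euclidean_space) chart set \<Rightarrow> 'a set
       \<Rightarrow> ('a \<Rightarrow> ('a, 'e) tangent_vector \<Rightarrow> real) \<Rightarrow> bool" where
  "flat_metric_on X A U \<phi> \<longleftrightarrow>
     finsler_metric_on X A U \<phi> \<and>
     (\<forall>x\<in>U. \<exists>g N. is_chart X g \<and> x \<in> fst g \<and> fst g \<subseteq> U \<and>
        (\<forall>c\<in>A. smooth_transition c g \<and> smooth_transition g c) \<and>
        banach_minkowski_norm N \<and> isometric_on A (fst g) \<phi> (snd g) N)"

definition second_order_flat_at ::
    "'a topology \<Rightarrow> ('a, 'e::euclidean_space) chart set
       \<Rightarrow> ('a \<Rightarrow> ('a, 'e) tangent_vector \<Rightarrow> real) \<Rightarrow> 'a \<Rightarrow> bool" where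
  "second_order_flat_at X A \<phi> p \<longleftrightarrow>
     (\<exists>U \<phi>0. p \<in> U \<and> flat_metric_on X A U \<phi>0 \<and>
        (\<exists>c \<in> charts_at A p. \<forall>\<epsilon>>0. \<forall>\<^sub>F x in atin X p.
           \<forall>v \<in> tangent_space A x - {zero_tangent}.
             \<bar>\<phi> x v / \<phi>0 x v - 1\<bar> \<le> \<epsilon> * (dist (snd c x) (snd c p))\<^sup>2))"

section \<open>The second fundamental form\<close>

text \<open>The Hessian at a point where the differential of \<open>h\<close> vanishes, so that it does not
  depend on the chart.\<close>

definition hessian_at ::
    "('a, 'e::euclidean_space) chart set \<Rightarrow> ('a \<Rightarrow> 'q::euclidean_space) \<Rightarrow> 'a
       \<Rightarrow> ('a, 'e) tangent_vector \<Rightarrow> ('a, 'e) tangent_vector \<Rightarrow> 'q" where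
  "hessian_at A h p u v =
     (let c = (SOME c. c \<in> charts_at A p)
      in second_derivative (h \<circ> chart_inv c) (snd c p) (u c) (v c))"

text \<open>
  The map \<open>\<pi>\<close> identifies the quotient of its domain by \<open>W\<close> with \<^typ>\<open>'q\<close>. For a one-dimensional
  quotient and \<^typ>\<open>real\<close> as codomain, \<open>\<pi>\<close> is unique up to a nonzero constant factor.
\<close>

definition quotient_projection ::
    "'v::euclidean_space set \<Rightarrow> ('v \<Rightarrow> 'q::euclidean_space) \<Rightarrow> bool" where
  "quotient_projection W \<pi> \<longleftrightarrow> linear \<pi> \<and> surj \<pi> \<and> {w. \<pi> w = 0} = W"

definition second_fundamental_form ::
    "('a, 'e::euclidean_space) chart set \<Rightarrow> ('a \<Rightarrow> 'v::euclidean_space)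
       \<Rightarrow> ('v \<Rightarrow> 'q::euclidean_space) \<Rightarrow> 'a
       \<Rightarrow> ('a, 'e) tangent_vector \<Rightarrow> ('a, 'e) tangent_vector \<Rightarrow> 'q" where
  "second_fundamental_form A f \<pi> p = hessian_at A (\<pi> \<circ> f) p"

definition degenerate_form ::
    "('a, 'e::euclidean_space) tangent_vector set
       \<Rightarrow> (('a, 'e) tangent_vector \<Rightarrow> ('a, 'e) tangent_vector \<Rightarrow> 'q::zero) \<Rightarrow> bool" where
  "degenerate_form T B \<longleftrightarrow> (\<exists>u\<in>T. u \<noteq> zero_tangent \<and> (\<forall>v\<in>T. B u v = 0))"

end

theory Submission
  imports Defs
begin

text \<open>
  Read \<open>f\<close> in flat coordinates around \<open>p\<close> as a map \<open>H\<close>, with derivatives \<open>L\<close>, \<open>B\<close>, \<open>T\<close> of order one, two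
  and three at \<open>p\<close>, let \<open>\<Psi> = \<Phi>\<^sup>2\<close> and let \<open>\<nu>(v)\<close> be the differential of \<open>\<Psi>\<close> at \<open>L v\<close>. Second-order flatness says
  that \<open>\<Psi>(dH v)\<close> is constant up to \<open>o(|x|\<^sup>2)\<close> for every fixed \<open>v\<close>, that is, \<open>\<nu>(v) B(v,w) = 0\<close> and
  \<open>d\<^sup>2\<Psi>(B(v,w), B(v,u)) + \<nu>(v) T(v,w,u) = 0\<close>. Suppose that the second fundamental form \<open>h\<close> is
  nondegenerate and let \<open>w(v)\<close>, linear in \<open>v\<close>, be the \<open>h\<close>-orthogonal direction of \<open>v\<close>. Then \<open>B(v,w(v))\<close>
  is a quadratic map into the tangent plane annihilated by \<open>\<nu>(v)\<close>, while \<open>\<nu>(v) L v > 0\<close>; this forces it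
  to vanish, so \<open>B = h n\<close> for a transversal vector \<open>n\<close>. The second equation now shows that
  \<open>T(v,w(v),u)\<close> modulo \<open>n\<close> is, for each fixed \<open>u\<close>, a quadratic map of the same kind. So \<open>T\<close> is a multiple of
  \<open>n\<close> as well, and the second equation gives \<open>d\<^sup>2\<Psi>(n,n) = 0\<close>, contrary to strict convexity.
\<close>

section \<open>Locality, algebra and composition of C^n functions\<close>

section \<open>Calculus of smooth functions\<close>

text \<open>\<open>frechet_derivative\<close> is a choice among the derivatives at the point.
  Functions that agree near the point have the same derivatives, so the choices coincide, even at
  points where there is none.\<close>

lemma frechet_derivative_cong_open:
  assumes "open S" "x \<in> S" "\<And>y. y \<in> S \<Longrightarrow> f y = g y"
  shows "frechet_derivative f (at x) = frechet_derivative g (at x)"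
proof -
  have "(f has_derivative D) (at x) \<longleftrightarrow> (g has_derivative D) (at x)" for D
    using has_derivative_transform_within_open[OF _ assms(1,2), of f D UNIV g]
      has_derivative_transform_within_open[OF _ assms(1,2), of g D UNIV f] assms(3) by auto
  then show ?thesis unfolding frechet_derivative_def by simp
qed

lemma differentiable_cong_open:
  assumes "open S" "x \<in> S" "\<And>y. y \<in> S \<Longrightarrow> f y = g y" "f differentiable (at x)"
  shows "g differentiable (at x)"
  using assms has_derivative_transform_within_open[OF _ assms(1,2), of f _ UNIV g]
  unfolding differentiable_def by blast

lemma C_diff_on_cong:
  assumes "open S" "\<And>x. x \<in> S \<Longrightarrow> f x = g x" "C_diff_on n S f"
  shows "C_diff_on n S g"
  using assms(2,3)
proof (induction n arbitrary: f g)
  case 0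
  then show ?case by (simp cong: continuous_on_cong)
next
  case (Suc n)
  have "g differentiable (at x)" if "x \<in> S" for x
    using differentiable_cong_open[OF assms(1) that Suc.prems(1)] Suc.prems(2) that by auto
  moreover have "C_diff_on n S (\<lambda>x. frechet_derivative g (at x) v)" for v
  proof (rule Suc.IH)
    show "C_diff_on n S (\<lambda>x. frechet_derivative f (at x) v)" using Suc.prems(2) by auto
    show "frechet_derivative f (at x) v = frechet_derivative g (at x) v" if "x \<in> S" for x
      using frechet_derivative_cong_open[OF assms(1) that Suc.prems(1)] by auto
  qed
  ultimately show ?case by simp
qed

text \<open>The recursion records only differentiability and the class of the directional
  derivatives. Descending through it ends at the fact that a differentiable function is
  continuous.\<close>

lemma C_diff_on_SucD: "C_diff_on (Suc n) S f \<Longrightarrow> C_diff_on n S f"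
proof (induction n arbitrary: f)
  case 0
  then show ?case
    by (auto intro!: continuous_at_imp_continuous_on differentiable_imp_continuous_within)
next
  case (Suc n)
  then show ?case by (metis C_diff_on.simps(2))
qed

lemma C_diff_on_subset: "T \<subseteq> S \<Longrightarrow> C_diff_on n S f \<Longrightarrow> C_diff_on n T f"
proof (induction n arbitrary: f)
  case 0
  then show ?case by (auto intro: continuous_on_subset)
qed auto

lemma C_diff_on_const: "C_diff_on n S (\<lambda>_. c)"
proof (induction n arbitrary: c)
  case (Suc n)
  then show ?case using Suc[of 0] by simp
qed simp

lemma C_diff_on_add:
  assumes "open S" "C_diff_on n S f" "C_diff_on n S g"
  shows "C_diff_on n S (\<lambda>x. f x + g x)"
  using assms(2,3)
proof (induction n arbitrary: f g)
  case 0
  then show ?case by (auto intro: continuous_intros)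
next
  case (Suc n)
  have "C_diff_on n S (\<lambda>x. frechet_derivative (\<lambda>x. f x + g x) (at x) v)" for v
  proof (rule C_diff_on_cong[OF assms(1)])
    show "C_diff_on n S (\<lambda>x. frechet_derivative f (at x) v + frechet_derivative g (at x) v)"
      using Suc by auto
    show "frechet_derivative f (at x) v + frechet_derivative g (at x) v
        = frechet_derivative (\<lambda>x. f x + g x) (at x) v" if "x \<in> S" for x
    proof -
      have "((\<lambda>x. f x + g x) has_derivative
          (\<lambda>v. frechet_derivative f (at x) v + frechet_derivative g (at x) v)) (at x)"
        using Suc.prems that by (auto intro!: derivative_intros simp: frechet_derivative_works)
      from frechet_derivative_at[OF this] show ?thesis by metis
    qed
  qed
  then show ?case using Suc.prems by auto
qed

lemma C_diff_on_scaleR: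
  fixes a :: "'a::real_normed_vector \<Rightarrow> real"
  assumes "open S" "C_diff_on n S a" "C_diff_on n S f"
  shows "C_diff_on n S (\<lambda>x. a x *\<^sub>R f x)"
  using assms(2,3)
proof (induction n arbitrary: a f)
  case 0
  then show ?case by (auto intro: continuous_intros)
next
  case (Suc n)
  let ?D = "\<lambda>x v. a x *\<^sub>R frechet_derivative f (at x) v + frechet_derivative a (at x) v *\<^sub>R f x"
  have D: "((\<lambda>x. a x *\<^sub>R f x) has_derivative ?D x) (at x)" if "x \<in> S" for x
    using Suc.prems that by (auto intro!: derivative_intros simp: frechet_derivative_works)
  have "C_diff_on n S (\<lambda>x. frechet_derivative (\<lambda>x. a x *\<^sub>R f x) (at x) v)" for v
  proof (rule C_diff_on_cong[OF assms(1)])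
    show "C_diff_on n S (\<lambda>x. ?D x v)"
      using Suc C_diff_on_SucD[OF Suc.prems(1)] C_diff_on_SucD[OF Suc.prems(2)]
      by (auto intro!: C_diff_on_add[OF assms(1)])
    show "?D x v = frechet_derivative (\<lambda>x. a x *\<^sub>R f x) (at x) v" if "x \<in> S" for x
      using frechet_derivative_at[OF D[OF that]] by metis
  qed
  moreover have "\<forall>x\<in>S. (\<lambda>x. a x *\<^sub>R f x) differentiable (at x)"
    using D unfolding differentiable_def by blast
  ultimately show ?case by simp
qed

lemma C_diff_on_sum:
  assumes "open S" "\<And>i. i \<in> I \<Longrightarrow> C_diff_on n S (f i)"
  shows "C_diff_on n S (\<lambda>x. \<Sum>i\<in>I. f i x)"
  using assms(2)
proof (induction I rule: infinite_finite_induct)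
  case (insert i I)
  then show ?case using C_diff_on_add[OF assms(1), of n "f i" "\<lambda>x. \<Sum>i\<in>I. f i x"] by simp
qed (simp_all add: C_diff_on_const)

lemma C_diff_on_bounded_linear:
  assumes "open S" "bounded_linear F" "C_diff_on n S f"
  shows "C_diff_on n S (\<lambda>x. F (f x))"
  using assms(3)
proof (induction n arbitrary: f)
  case 0
  then show ?case
    using assms(2) by (auto intro: continuous_intros bounded_linear.continuous_on)
next
  case (Suc n)
  have D: "((\<lambda>x. F (f x)) has_derivative (\<lambda>v. F (frechet_derivative f (at x) v))) (at x)"
    if "x \<in> S" for x
    using Suc.prems that
    by (auto intro!: bounded_linear.has_derivative[OF assms(2)] simp: frechet_derivative_works)
  have "C_diff_on n S (\<lambda>x. frechet_derivative (\<lambda>x. F (f x)) (at x) v)" for v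
  proof (rule C_diff_on_cong[OF assms(1)])
    show "C_diff_on n S (\<lambda>x. F (frechet_derivative f (at x) v))"
      using Suc by auto
    show "F (frechet_derivative f (at x) v) = frechet_derivative (\<lambda>x. F (f x)) (at x) v"
      if "x \<in> S" for x
      using frechet_derivative_at[OF D[OF that]] by metis
  qed
  moreover have "\<forall>x\<in>S. (\<lambda>x. F (f x)) differentiable (at x)"
    using D unfolding differentiable_def by blast
  ultimately show ?case by simp
qed

lemma linear_eq_sum_Basis:
  fixes D :: "'a::euclidean_space \<Rightarrow> 'b::real_vector"
  assumes "linear D"
  shows "D w = (\<Sum>i\<in>Basis. (w \<bullet> i) *\<^sub>R D i)"
proof -
  have "D w = D (\<Sum>i\<in>Basis. (w \<bullet> i) *\<^sub>R i)" by (simp add: euclidean_representation)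
  also have "\<dots> = (\<Sum>i\<in>Basis. (w \<bullet> i) *\<^sub>R D i)"
    by (simp add: linear_sum[OF assms] linear_scale[OF assms])
  finally show ?thesis .
qed

text \<open>The derivative of \<open>F \<circ> t\<close> evaluates dF in the direction dt(v), which
  moves with the point, whereas \<open>C_diff_on\<close> speaks of fixed directions only. Expanding
  dt(v) in the basis gives a finite sum of products, to which the induction hypothesis and the
  product rule apply.\<close>

lemma C_diff_on_compose:
  fixes F :: "'b::euclidean_space \<Rightarrow> 'c::real_normed_vector"
    and t :: "'a::real_normed_vector \<Rightarrow> 'b"
  assumes "open S" "t ` S \<subseteq> T" "C_diff_on n T F" "C_diff_on n S t"
  shows "C_diff_on n S (F \<circ> t)"
  using assms(3,4)
proof (induction n arbitrary: F)
  case 0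
  then show ?case using assms(2) continuous_on_compose[of S t F] continuous_on_subset[of T F] by auto
next
  case (Suc n)
  let ?D = "\<lambda>x v. frechet_derivative F (at (t x)) (frechet_derivative t (at x) v)"
  have diff: "F differentiable at (t x)" if "x \<in> S" for x
    using Suc.prems that assms(2) by auto
  have D: "((F \<circ> t) has_derivative ?D x) (at x)" if "x \<in> S" for x
    using diff_chain_at[of t "frechet_derivative t (at x)" x F "frechet_derivative F (at (t x))"]
      Suc.prems that diff[OF that] by (auto simp: frechet_derivative_works o_def)
  have "C_diff_on n S (\<lambda>x. frechet_derivative (F \<circ> t) (at x) v)" for v
  proof (rule C_diff_on_cong[OF assms(1)])
    show "C_diff_on n S (\<lambda>x. \<Sum>i\<in>Basis. (frechet_derivative t (at x) v \<bullet> i) *\<^sub>R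
              ((\<lambda>y. frechet_derivative F (at y) i) \<circ> t) x)"
    proof (intro C_diff_on_sum C_diff_on_scaleR assms(1))
      fix i :: 'b
      show "C_diff_on n S (\<lambda>x. frechet_derivative t (at x) v \<bullet> i)"
        by (rule C_diff_on_bounded_linear[OF assms(1) bounded_linear_inner_left])
          (use Suc.prems(2) in simp)
      show "C_diff_on n S ((\<lambda>y. frechet_derivative F (at y) i) \<circ> t)"
        by (rule Suc.IH[OF _ C_diff_on_SucD[OF Suc.prems(2)]]) (use Suc.prems(1) in simp)
    qed
    show "(\<Sum>i\<in>Basis. (frechet_derivative t (at x) v \<bullet> i) *\<^sub>R
              ((\<lambda>y. frechet_derivative F (at y) i) \<circ> t) x)
        = frechet_derivative (F \<circ> t) (at x) v" if "x \<in> S" for x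
      using fun_cong[OF frechet_derivative_at[OF D[OF that]], of v]
        linear_eq_sum_Basis[OF linear_frechet_derivative[OF diff[OF that]],
            of "frechet_derivative t (at x) v"] by simp
  qed
  moreover have "\<forall>x\<in>S. (F \<circ> t) differentiable (at x)"
    using D unfolding differentiable_def by blast
  ultimately show ?case unfolding C_diff_on.simps by blast
qed

lemma smooth_on_subset: "smooth_on S f \<Longrightarrow> T \<subseteq> S \<Longrightarrow> smooth_on T f"
  using C_diff_on_subset[of T S] unfolding smooth_on_def by blast

lemma smooth_on_cong:
  "open S \<Longrightarrow> (\<And>x. x \<in> S \<Longrightarrow> f x = g x) \<Longrightarrow> smooth_on S f \<Longrightarrow> smooth_on S g"
  using C_diff_on_cong[of S f g] unfolding smooth_on_def by blast

lemma smooth_on_compose: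
  fixes F :: "'b::euclidean_space \<Rightarrow> 'c::real_normed_vector"
  assumes "open S" "t ` S \<subseteq> T" "smooth_on T F" "smooth_on S t"
  shows "smooth_on S (F \<circ> t)"
  using C_diff_on_compose[OF assms(1,2)] assms(3,4) unfolding smooth_on_def by blast

lemma smooth_on_bounded_linear:
  assumes "open S" "bounded_linear F" "smooth_on S f"
  shows "smooth_on S (\<lambda>x. F (f x))"
  using C_diff_on_bounded_linear[OF assms(1,2)] assms(3) unfolding smooth_on_def by blast

lemma smooth_on_power2:
  fixes f :: "'a::real_normed_vector \<Rightarrow> real"
  assumes "open S" "smooth_on S f"
  shows "smooth_on S (\<lambda>x. (f x)\<^sup>2)"
  using C_diff_on_scaleR[OF assms(1), of _ f f] assms(2)
  by (simp add: smooth_on_def power2_eq_square)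

lemma smooth_on_frechet_derivative:
  "smooth_on S f \<Longrightarrow> smooth_on S (\<lambda>x. frechet_derivative f (at x) v)"
  unfolding smooth_on_def by (metis C_diff_on.simps(2))

lemma smooth_on_has_derivative:
  "smooth_on S f \<Longrightarrow> x \<in> S \<Longrightarrow> (f has_derivative frechet_derivative f (at x)) (at x)"
  unfolding smooth_on_def by (metis C_diff_on.simps(2) frechet_derivative_works)

lemma smooth_on_differentiable:
  "smooth_on S f \<Longrightarrow> x \<in> S \<Longrightarrow> f differentiable (at x)"
  unfolding differentiable_def by (blast dest: smooth_on_has_derivative)

lemma smooth_on_linear_frechet:
  "smooth_on S f \<Longrightarrow> x \<in> S \<Longrightarrow> linear (frechet_derivative f (at x))"
  by (rule linear_frechet_derivative[OF smooth_on_differentiable])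

lemma smooth_on_continuous_on: "smooth_on S f \<Longrightarrow> continuous_on S f"
  unfolding smooth_on_def by (metis C_diff_on.simps(1))

lemma smooth_on_chain:
  assumes "smooth_on S t" "x \<in> S" "smooth_on T F" "t x \<in> T"
  shows "frechet_derivative (F \<circ> t) (at x) v
    = frechet_derivative F (at (t x)) (frechet_derivative t (at x) v)"
  using frechet_derivative_compose[OF smooth_on_differentiable[OF assms(1,2)]
      smooth_on_differentiable[OF assms(3,4)]] by simp

section \<open>Bilinearity and the chain rule for second derivatives\<close>

lemma linear_second_derivative_left:
  assumes "smooth_on S f" "x \<in> S"
  shows "linear (\<lambda>u. second_derivative f x u w)"
  using smooth_on_linear_frechet[OF smooth_on_frechet_derivative[OF assms(1)] assms(2)]
  unfolding second_derivative_def .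

text \<open>The second argument is the direction of the inner derivative. That derivative is linear
  in its direction at every point of \<open>S\<close>, and differentiating these identities at
  \<open>x\<close> preserves them.\<close>

lemma linear_second_derivative_right:
  assumes "open S" "smooth_on S f" "x \<in> S"
  shows "linear (second_derivative f x u)"
proof
  let ?D = "\<lambda>w y. frechet_derivative f (at y) w"
  note D = smooth_on_has_derivative[OF smooth_on_frechet_derivative[OF assms(2)] assms(3)]
  note L = smooth_on_linear_frechet[OF assms(2)]
  fix w1 w2 :: 'a and c :: real
  have "frechet_derivative (?D (w1 + w2)) (at x) = frechet_derivative (\<lambda>y. ?D w1 y + ?D w2 y) (at x)"
    using L linear_add by (intro frechet_derivative_cong_open[OF assms(1,3)]) blast
  also have "\<dots> = (\<lambda>v. frechet_derivative (?D w1) (at x) v + frechet_derivative (?D w2) (at x) v)"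
    by (rule frechet_derivative_at[symmetric]) (intro derivative_intros D)
  finally show "second_derivative f x u (w1 + w2) = second_derivative f x u w1 + second_derivative f x u w2"
    unfolding second_derivative_def by simp
  have "frechet_derivative (?D (c *\<^sub>R w1)) (at x) = frechet_derivative (\<lambda>y. c *\<^sub>R ?D w1 y) (at x)"
    using L linear_scale by (intro frechet_derivative_cong_open[OF assms(1,3)]) blast
  also have "\<dots> = (\<lambda>v. c *\<^sub>R frechet_derivative (?D w1) (at x) v)"
    by (rule frechet_derivative_at[symmetric]) (intro derivative_intros D)
  finally show "second_derivative f x u (c *\<^sub>R w1) = c *\<^sub>R second_derivative f x u w1"
    unfolding second_derivative_def by simp
qed

lemma second_derivative_bounded_linear:
  assumes "open S" "smooth_on S f" "x \<in> S" "bounded_linear F"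
  shows "second_derivative (F \<circ> f) x u w = F (second_derivative f x u w)"
proof -
  have 1: "frechet_derivative (F \<circ> f) (at y) w = F (frechet_derivative f (at y) w)" if "y \<in> S" for y
    using fun_cong[OF frechet_derivative_at[OF bounded_linear.has_derivative[OF assms(4)
          smooth_on_has_derivative[OF assms(2) that]]], of w] by (simp add: comp_def)
  have "frechet_derivative (\<lambda>y. frechet_derivative (F \<circ> f) (at y) w) (at x)
      = frechet_derivative (\<lambda>y. F (frechet_derivative f (at y) w)) (at x)"
    by (rule frechet_derivative_cong_open[OF assms(1,3)]) (rule 1)
  also have "\<dots> = (\<lambda>v. F (frechet_derivative (\<lambda>y. frechet_derivative f (at y) w) (at x) v))"
    using frechet_derivative_at[OF bounded_linear.has_derivative[OF assms(4)
        smooth_on_has_derivative[OF smooth_on_frechet_derivative[OF assms(2)] assms(3)]]] by (rule sym)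
  finally show ?thesis unfolding second_derivative_def by simp
qed

text \<open>The first derivative of the composition is dF at t(y) in the moving direction
  \<open>d y\<close>. Once this direction is expanded in the basis, the product rule yields one term
  from the base point of dF and one from its direction.\<close>

lemma second_derivative_compose:
  fixes F :: "'b::euclidean_space \<Rightarrow> 'c::real_normed_vector"
    and t :: "'a::real_normed_vector \<Rightarrow> 'b"
  assumes "open S" "x \<in> S" "t ` S \<subseteq> T" "open T" "smooth_on T F" "smooth_on S t"
  shows "second_derivative (F \<circ> t) x u w =
      second_derivative F (t x) (frechet_derivative t (at x) u) (frechet_derivative t (at x) w)
      + frechet_derivative F (at (t x)) (second_derivative t x u w)"
proof -
  define d where "d = (\<lambda>y. frechet_derivative t (at y) w)"
  define G where "G = (\<lambda>i y. frechet_derivative F (at y) i)"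
  have tx: "t x \<in> T" using assms by auto
  have d: "(d has_derivative (\<lambda>u. second_derivative t x u w)) (at x)"
    using smooth_on_has_derivative[OF smooth_on_frechet_derivative[OF assms(6)] assms(2)]
    unfolding d_def second_derivative_def .
  have G: "(G i has_derivative (\<lambda>u. second_derivative F (t x) u i)) (at (t x))" for i
    using smooth_on_has_derivative[OF smooth_on_frechet_derivative[OF assms(5)] tx]
    unfolding G_def second_derivative_def .
  have t: "(t has_derivative frechet_derivative t (at x)) (at x)"
    using smooth_on_has_derivative assms by blast
  have eq: "frechet_derivative (F \<circ> t) (at y) w = (\<Sum>i\<in>Basis. (d y \<bullet> i) *\<^sub>R G i (t y))" if "y \<in> S" for y
  proof -
    have ty: "t y \<in> T" using that assms by auto
    have "frechet_derivative (F \<circ> t) (at y) w = frechet_derivative F (at (t y)) (d y)"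
      using smooth_on_chain[OF assms(6) that assms(5) ty] unfolding d_def .
    then show ?thesis
      unfolding G_def using linear_eq_sum_Basis[OF smooth_on_linear_frechet[OF assms(5) ty]] by metis
  qed
  have Gt: "((\<lambda>y. G i (t y)) has_derivative (\<lambda>u. second_derivative F (t x) (frechet_derivative t (at x) u) i)) (at x)" for i
    using diff_chain_at[OF t G[of i]] by (simp add: o_def)
  have "((\<lambda>y. \<Sum>i\<in>Basis. (d y \<bullet> i) *\<^sub>R G i (t y)) has_derivative
      (\<lambda>u. \<Sum>i\<in>Basis. (d x \<bullet> i) *\<^sub>R second_derivative F (t x) (frechet_derivative t (at x) u) i
         + (second_derivative t x u w \<bullet> i) *\<^sub>R G i (t x))) (at x)"
    by (intro derivative_intros Gt d)
  from frechet_derivative_at[OF this, symmetric]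
  have "frechet_derivative (\<lambda>y. \<Sum>i\<in>Basis. (d y \<bullet> i) *\<^sub>R G i (t y)) (at x) u =
      (\<Sum>i\<in>Basis. (d x \<bullet> i) *\<^sub>R second_derivative F (t x) (frechet_derivative t (at x) u) i
         + (second_derivative t x u w \<bullet> i) *\<^sub>R G i (t x))"
    by (rule fun_cong)
  also have "\<dots> = second_derivative F (t x) (frechet_derivative t (at x) u) (d x)
      + frechet_derivative F (at (t x)) (second_derivative t x u w)"
    using linear_eq_sum_Basis[OF linear_second_derivative_right[OF assms(4,5) tx], of _ "d x"]
      linear_eq_sum_Basis[OF smooth_on_linear_frechet[OF assms(5) tx], of "second_derivative t x u w"]
    by (simp add: sum.distrib G_def)
  finally have *: "frechet_derivative (\<lambda>y. \<Sum>i\<in>Basis. (d y \<bullet> i) *\<^sub>R G i (t y)) (at x) u = \<dots>" .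
  have "frechet_derivative (\<lambda>y. frechet_derivative (F \<circ> t) (at y) w) (at x)
      = frechet_derivative (\<lambda>y. \<Sum>i\<in>Basis. (d y \<bullet> i) *\<^sub>R G i (t y)) (at x)"
    using eq by (intro frechet_derivative_cong_open[OF assms(1,2)])
  with * show ?thesis unfolding second_derivative_def[of "F \<circ> t"] by (simp add: d_def)
qed

section \<open>Symmetry of second derivatives\<close>

lemma smooth_on_has_real_derivative_line:
  fixes f :: "'a::real_normed_vector \<Rightarrow> real"
  assumes "smooth_on S f" "y + t *\<^sub>R v \<in> S"
  shows "((\<lambda>t. f (y + t *\<^sub>R v)) has_real_derivative frechet_derivative f (at (y + t *\<^sub>R v)) v) (at t)"
proof -
  let ?D = "frechet_derivative f (at (y + t *\<^sub>R v))"
  have "((\<lambda>t. y + t *\<^sub>R v) has_derivative (\<lambda>h. h *\<^sub>R v)) (at t)"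
    by (auto intro!: derivative_eq_intros)
  from diff_chain_at[OF this smooth_on_has_derivative[OF assms]]
  have "((\<lambda>t. f (y + t *\<^sub>R v)) has_derivative (\<lambda>h. ?D (h *\<^sub>R v))) (at t)"
    by (simp add: o_def)
  moreover have "(\<lambda>h. ?D (h *\<^sub>R v)) = (*) (?D v)"
    using linear_scale[OF smooth_on_linear_frechet[OF assms]] by (simp add: fun_eq_iff)
  ultimately show ?thesis by (simp add: has_field_derivative_def)
qed

text \<open>Two applications of the mean value theorem: first along \<open>u\<close> to the
  difference of \<open>f\<close> on two opposite sides of the parallelogram, then along
  \<open>w\<close> to the derivative of \<open>f\<close> in direction \<open>u\<close>.\<close>

lemma second_difference_eq_second_derivative:
  fixes f :: "'a::real_normed_vector \<Rightarrow> real"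
  assumes "smooth_on S f" "0 < s"
    and S: "\<And>a b. 0 \<le> a \<Longrightarrow> a \<le> s \<Longrightarrow> 0 \<le> b \<Longrightarrow> b \<le> s \<Longrightarrow> x + a *\<^sub>R u + b *\<^sub>R w \<in> S"
  shows "\<exists>a b. 0 \<le> a \<and> a \<le> s \<and> 0 \<le> b \<and> b \<le> s \<and>
     f (x + s *\<^sub>R u + s *\<^sub>R w) - f (x + s *\<^sub>R u) - f (x + s *\<^sub>R w) + f x
       = s\<^sup>2 * second_derivative f (x + a *\<^sub>R u + b *\<^sub>R w) w u"
proof -
  define D where "D = (\<lambda>y. frechet_derivative f (at y) u)"
  have sm: "smooth_on S D" unfolding D_def by (rule smooth_on_frechet_derivative[OF assms(1)])
  define g where "g = (\<lambda>t. f ((x + s *\<^sub>R w) + t *\<^sub>R u) - f (x + t *\<^sub>R u))"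
  have g: "(g has_real_derivative D ((x + s *\<^sub>R w) + t *\<^sub>R u) - D (x + t *\<^sub>R u)) (at t)"
    if "0 \<le> t" "t \<le> s" for t
    unfolding g_def D_def using S[OF that, of s] S[OF that, of 0] \<open>0 < s\<close>
    by (intro derivative_intros smooth_on_has_real_derivative_line[OF assms(1)])
      (simp_all add: algebra_simps)
  obtain a where a: "0 < a" "a < s" "g s - g 0 = s * (D ((x + s *\<^sub>R w) + a *\<^sub>R u) - D (x + a *\<^sub>R u))"
    using MVT2[OF \<open>0 < s\<close> g] by auto
  have "((\<lambda>t. D ((x + a *\<^sub>R u) + t *\<^sub>R w)) has_real_derivative
      frechet_derivative D (at ((x + a *\<^sub>R u) + t *\<^sub>R w)) w) (at t)" if "0 \<le> t" "t \<le> s" for t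
    using S[of a t] a that by (intro smooth_on_has_real_derivative_line[OF sm]) simp_all
  from MVT2[OF \<open>0 < s\<close> this] obtain b where b: "0 < b" "b < s"
    "D ((x + a *\<^sub>R u) + s *\<^sub>R w) - D (x + a *\<^sub>R u)
      = s * frechet_derivative D (at (x + a *\<^sub>R u + b *\<^sub>R w)) w"
    by auto
  have "g s - g 0 = s\<^sup>2 * frechet_derivative D (at (x + a *\<^sub>R u + b *\<^sub>R w)) w"
    using a(3) b(3) by (simp add: power2_eq_square add_ac)
  moreover have "g s - g 0 = f (x + s *\<^sub>R u + s *\<^sub>R w) - f (x + s *\<^sub>R u) - f (x + s *\<^sub>R w) + f x"
    unfolding g_def by (simp add: algebra_simps)
  ultimately show ?thesis
    using a(1,2) b(1,2) unfolding second_derivative_def D_def by (intro exI[of _ a] exI[of _ b]) auto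
qed

lemma smooth_on_second_derivative:
  "smooth_on S f \<Longrightarrow> smooth_on S (\<lambda>y. second_derivative f y u w)"
  unfolding second_derivative_def by (intro smooth_on_frechet_derivative)

lemma second_derivative_near:
  fixes f :: "'a::real_normed_vector \<Rightarrow> real"
  assumes "open S" "smooth_on S f" "x \<in> S" "0 < e"
  shows "\<exists>d>0. \<forall>y. dist y x < d \<longrightarrow> y \<in> S \<and> \<bar>second_derivative f y u w - second_derivative f x u w\<bar> < e"
proof -
  have "continuous (at x) (\<lambda>y. second_derivative f y u w)"
    using smooth_on_continuous_on[OF smooth_on_second_derivative[OF assms(2)]] assms(1,3)
    by (simp add: continuous_on_eq_continuous_at)
  then obtain d1 where d1: "d1 > 0"
    "\<And>y. dist y x < d1 \<Longrightarrow> \<bar>second_derivative f y u w - second_derivative f x u w\<bar> < e"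
    using assms(4) by (auto simp: continuous_at_eps_delta dist_real_def)
  obtain d2 where d2: "d2 > 0" "\<And>y. dist y x < d2 \<Longrightarrow> y \<in> S"
    using assms(1,3) by (auto simp: open_dist)
  show ?thesis using d1 d2 by (intro exI[of _ "min d1 d2"]) auto
qed

text \<open>The second difference over a small parallelogram is symmetric in \<open>u\<close> and
  \<open>w\<close>, and it equals \<open>s\<^sup>2\<close> times either mixed derivative at some
  nearby point. By continuity the two mixed derivatives at \<open>x\<close> cannot differ.\<close>

lemma second_derivative_commute_real:
  fixes f :: "'a::real_normed_vector \<Rightarrow> real"
  assumes "open S" "smooth_on S f" "x \<in> S"
  shows "second_derivative f x u w = second_derivative f x w u"
proof (rule ccontr)
  assume ne: "second_derivative f x u w \<noteq> second_derivative f x w u"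
  define e where "e = \<bar>second_derivative f x u w - second_derivative f x w u\<bar> / 2"
  have "e > 0" using ne by (simp add: e_def)
  obtain d1 where d1: "d1 > 0"
    "\<And>y. dist y x < d1 \<Longrightarrow> y \<in> S \<and> \<bar>second_derivative f y u w - second_derivative f x u w\<bar> < e"
    using second_derivative_near[OF assms \<open>e > 0\<close>] by blast
  obtain d2 where d2: "d2 > 0"
    "\<And>y. dist y x < d2 \<Longrightarrow> y \<in> S \<and> \<bar>second_derivative f y w u - second_derivative f x w u\<bar> < e"
    using second_derivative_near[OF assms \<open>e > 0\<close>] by blast
  define d where "d = min d1 d2"
  \<comment> \<open>The parallelogram with sides \<open>s u\<close> and \<open>s w\<close> then lies
    in the ball of radius \<open>d\<close>; the summand 1 keeps the denominator positive.\<close>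
  define s where "s = d / (norm u + norm w + 1)"
  have pos: "norm u + norm w + 1 > 0" using norm_ge_zero[of u] norm_ge_zero[of w] by linarith
  have "d > 0" using d1(1) d2(1) by (simp add: d_def)
  then have "s > 0" using pos by (simp add: s_def)
  have "s * (norm u + norm w) < s * (norm u + norm w + 1)" using \<open>s > 0\<close> by (intro mult_strict_left_mono) auto
  also have "\<dots> = d" using pos by (simp add: s_def)
  finally have sd: "s * (norm u + norm w) < d" .
  have near: "dist (x + a *\<^sub>R u + b *\<^sub>R w) x < d" if "0 \<le> a" "a \<le> s" "0 \<le> b" "b \<le> s" for a b
  proof -
    have "dist (x + a *\<^sub>R u + b *\<^sub>R w) x = norm (a *\<^sub>R u + b *\<^sub>R w)"
      by (simp add: dist_norm add.assoc)
    also have "\<dots> \<le> a * norm u + b * norm w"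
      using norm_triangle_ineq[of "a *\<^sub>R u" "b *\<^sub>R w"] that by simp
    also have "\<dots> \<le> s * norm u + s * norm w"
      using that by (intro add_mono mult_right_mono) auto
    finally show ?thesis using sd by (simp add: algebra_simps)
  qed
  have near': "dist (x + a *\<^sub>R w + b *\<^sub>R u) x < d" if "0 \<le> a" "a \<le> s" "0 \<le> b" "b \<le> s" for a b
    using near[of b a] that by (simp add: add_ac)
  obtain a b where ab: "0 \<le> a" "a \<le> s" "0 \<le> b" "b \<le> s"
     "f (x + s *\<^sub>R u + s *\<^sub>R w) - f (x + s *\<^sub>R u) - f (x + s *\<^sub>R w) + f x
       = s\<^sup>2 * second_derivative f (x + a *\<^sub>R u + b *\<^sub>R w) w u"
    using second_difference_eq_second_derivative[OF assms(2) \<open>s > 0\<close>, of x u w] near d1(2) d_def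
    by (metis min_less_iff_conj)
  obtain a' b' where ab': "0 \<le> a'" "a' \<le> s" "0 \<le> b'" "b' \<le> s"
     "f (x + s *\<^sub>R w + s *\<^sub>R u) - f (x + s *\<^sub>R w) - f (x + s *\<^sub>R u) + f x
       = s\<^sup>2 * second_derivative f (x + a' *\<^sub>R w + b' *\<^sub>R u) u w"
    using second_difference_eq_second_derivative[OF assms(2) \<open>s > 0\<close>, of x w u] near' d1(2) d_def
    by (metis min_less_iff_conj)
  have "s\<^sup>2 * second_derivative f (x + a *\<^sub>R u + b *\<^sub>R w) w u
      = s\<^sup>2 * second_derivative f (x + a' *\<^sub>R w + b' *\<^sub>R u) u w"
    unfolding ab(5)[symmetric] ab'(5)[symmetric] by (simp add: algebra_simps)
  then have "second_derivative f (x + a *\<^sub>R u + b *\<^sub>R w) w u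
      = second_derivative f (x + a' *\<^sub>R w + b' *\<^sub>R u) u w"
    using \<open>s > 0\<close> by simp
  moreover have "\<bar>second_derivative f (x + a *\<^sub>R u + b *\<^sub>R w) w u - second_derivative f x w u\<bar> < e"
    using d2(2) near[OF ab(1-4)] by (simp add: d_def)
  moreover have "\<bar>second_derivative f (x + a' *\<^sub>R w + b' *\<^sub>R u) u w - second_derivative f x u w\<bar> < e"
    using d1(2) near'[OF ab'(1-4)] by (simp add: d_def)
  moreover have "2 * e = \<bar>second_derivative f x u w - second_derivative f x w u\<bar>" by (simp add: e_def)
  ultimately show False by argo
qed

lemma second_derivative_commute:
  fixes f :: "'a::real_normed_vector \<Rightarrow> 'b::euclidean_space"
  assumes "open S" "smooth_on S f" "x \<in> S"
  shows "second_derivative f x u w = second_derivative f x w u"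
proof (rule euclidean_eqI)
  fix i :: 'b
  let ?F = "\<lambda>v::'b. v \<bullet> i"
  have "smooth_on S (?F \<circ> f)"
    using smooth_on_bounded_linear[OF assms(1) bounded_linear_inner_left assms(2)] by (simp add: o_def)
  from second_derivative_commute_real[OF assms(1) this assms(3)]
  show "second_derivative f x u w \<bullet> i = second_derivative f x w u \<bullet> i"
    using second_derivative_bounded_linear[OF assms bounded_linear_inner_left] by metis
qed

text \<open>The analytic content of second-order flatness: a smooth function that is constant up to
  o(|y - y0|^2) has vanishing first and second derivatives at \<open>y0\<close>, by comparison with
  its Taylor formula.\<close>

lemma
  fixes k :: "'a::euclidean_space \<Rightarrow> real"
  assumes "open S" "smooth_on S k" "y0 \<in> S"
    and o: "\<And>e. e > 0 \<Longrightarrow> \<forall>\<^sub>F y in at y0. \<bar>k y - c\<bar> \<le> e * (dist y y0)\<^sup>2"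
  shows frechet_derivative_eq_0_of_small: "frechet_derivative k (at y0) w = 0"
    and second_derivative_eq_0_of_small: "second_derivative k y0 u w = 0"
proof -
  obtain d0 where d0: "d0 > 0" "\<And>y. y \<noteq> y0 \<Longrightarrow> dist y y0 < d0 \<Longrightarrow> \<bar>k y - c\<bar> \<le> (dist y y0)\<^sup>2"
    using o[of 1] unfolding eventually_at by auto
  have "(k \<longlongrightarrow> k y0) (at y0)"
    using smooth_on_continuous_on[OF assms(2)] assms(1,3)
    by (simp add: continuous_on_eq_continuous_at isCont_def)
  moreover have lim0: "((\<lambda>y. (dist y y0)\<^sup>2) \<longlongrightarrow> 0) (at y0)"
  proof -
    have "((\<lambda>y. (dist y y0)\<^sup>2) \<longlongrightarrow> (dist y0 y0)\<^sup>2) (at y0)" by (intro tendsto_intros)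
    then show ?thesis by simp
  qed
  have "((\<lambda>y. k y - c) \<longlongrightarrow> 0) (at y0)"
    by (rule Lim_null_comparison[OF _ lim0]) (use o[of 1] in simp)
  then have "(k \<longlongrightarrow> c) (at y0)" by (simp add: LIM_zero_iff)
  \<comment> \<open>The estimate holds on punctured neighbourhoods only; the value at
    \<open>y0\<close> comes from continuity.\<close>
  ultimately have c: "k y0 = c" by (intro tendsto_unique[of "at y0" k]) auto
  have "(k has_derivative (\<lambda>_. 0)) (at y0)"
  proof (rule has_derivativeI_sandwich[OF d0(1)])
    show "norm (k y - k y0 - 0) / norm (y - y0) \<le> norm (y - y0)" if "y \<noteq> y0" "dist y y0 < d0" for y
      using d0(2)[OF that] that(1) c by (simp add: dist_norm power2_eq_square divide_le_eq)
    show "((\<lambda>y. norm (y - y0)) \<longlongrightarrow> 0) (at y0)"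
    proof -
      have "((\<lambda>y. norm (y - y0)) \<longlongrightarrow> norm (y0 - y0)) (at y0)" by (intro tendsto_intros)
      then show ?thesis by simp
    qed
  qed auto
  from frechet_derivative_at[OF this] have D: "frechet_derivative k (at y0) = (\<lambda>_. 0)" by simp
  then show "frechet_derivative k (at y0) w = 0" by simp
  have diag: "second_derivative k y0 w w = 0" for w
  proof (rule ccontr)
    define m where "m = second_derivative k y0 w w"
    assume "second_derivative k y0 w w \<noteq> 0"
    then have m: "\<bar>m\<bar> > 0" by (simp add: m_def)
    have w: "norm w > 0"
      using m linear_0[OF linear_second_derivative_left[OF assms(2,3)]] by (auto simp: m_def)
    \<comment> \<open>This bounds the deviation of \<open>k\<close> from \<open>c\<close> at
      \<open>y0 + t w\<close> by |m| t^2 / 8. The Taylor remainder exceeds |m| t^2 / 4, because the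
      second derivative along the segment stays within |m| / 2 of \<open>m\<close>.\<close>
    define e where "e = \<bar>m\<bar> / (8 * (norm w)\<^sup>2)"
    have "e > 0" using m w by (simp add: e_def)
    obtain d1 where d1: "d1 > 0" "\<And>y. y \<noteq> y0 \<Longrightarrow> dist y y0 < d1 \<Longrightarrow> \<bar>k y - c\<bar> \<le> e * (dist y y0)\<^sup>2"
      using o[OF \<open>e > 0\<close>] unfolding eventually_at by auto
    obtain d2 where d2: "d2 > 0"
      "\<And>y. dist y y0 < d2 \<Longrightarrow> y \<in> S \<and> \<bar>second_derivative k y w w - m\<bar> < \<bar>m\<bar> / 2"
      using second_derivative_near[OF assms(1-3), of "\<bar>m\<bar> / 2" w w] m unfolding m_def by auto
    define t where "t = min d1 d2 / (2 * norm w)"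
    have "t > 0" using d1(1) d2(1) w by (simp add: t_def)
    have tw: "t * norm w < d1" "t * norm w < d2" using d1(1) d2(1) w by (auto simp: t_def min_def)
    have in_d2: "dist (y0 + s *\<^sub>R w) y0 < d2" if "0 \<le> s" "s \<le> t" for s
      using tw(2) mult_right_mono[OF that(2), of "norm w"] that by (simp add: dist_norm)
    \<comment> \<open>The successive derivatives along the segment, in the form that Maclaurin's
      formula takes; only the indices 0, 1 and 2 matter.\<close>
    define diff where "diff = (\<lambda>(n::nat) s. if n = 0 then k (y0 + s *\<^sub>R w)
      else if n = 1 then frechet_derivative k (at (y0 + s *\<^sub>R w)) w
      else second_derivative k (y0 + s *\<^sub>R w) w w)"
    have diff: "(diff n has_real_derivative diff (Suc n) s) (at s)" if "n < 2" "0 \<le> s" "s \<le> t" for n s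
    proof -
      have S: "y0 + s *\<^sub>R w \<in> S" using d2(2) in_d2[OF that(2,3)] by blast
      have "n = 0 \<or> n = 1" using that(1) by linarith
      then show ?thesis
      proof
        assume "n = 0"
        then show ?thesis
          using smooth_on_has_real_derivative_line[OF assms(2) S] by (simp add: diff_def)
      next
        assume "n = 1"
        then show ?thesis
          using smooth_on_has_real_derivative_line[OF smooth_on_frechet_derivative[OF assms(2)] S]
          by (simp add: diff_def second_derivative_def)
      qed
    qed
    obtain s where s: "0 < s" "s < t"
      "k (y0 + t *\<^sub>R w) = (\<Sum>n<2. diff n 0 / fact n * t ^ n) + diff 2 s / fact 2 * t ^ 2"
      using Maclaurin[OF \<open>t > 0\<close>, of 2 diff "\<lambda>s. k (y0 + s *\<^sub>R w)"] diff
      by (auto simp: diff_def)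
    then have "k (y0 + t *\<^sub>R w) - c = second_derivative k (y0 + s *\<^sub>R w) w w / 2 * t\<^sup>2"
      using c D by (simp add: diff_def numeral_2_eq_2)
    then have eq: "\<bar>k (y0 + t *\<^sub>R w) - c\<bar> = \<bar>second_derivative k (y0 + s *\<^sub>R w) w w\<bar> / 2 * t\<^sup>2"
      by (simp only: abs_mult abs_divide) simp
    have "\<bar>k (y0 + t *\<^sub>R w) - c\<bar> \<le> e * (dist (y0 + t *\<^sub>R w) y0)\<^sup>2"
      using w \<open>t > 0\<close> tw(1) by (intro d1(2)) (auto simp: dist_norm)
    also have "\<dots> = \<bar>m\<bar> / 8 * t\<^sup>2"
      using w by (simp add: e_def dist_norm power_mult_distrib)
    finally have "\<bar>second_derivative k (y0 + s *\<^sub>R w) w w\<bar> / 2 \<le> \<bar>m\<bar> / 8"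
      using \<open>t > 0\<close> unfolding eq by simp
    moreover have "\<bar>second_derivative k (y0 + s *\<^sub>R w) w w - m\<bar> < \<bar>m\<bar> / 2"
      using d2(2) in_d2[of s] s(1,2) by simp
    ultimately show False using m by linarith
  qed
  \<comment> \<open>Polarization: a symmetric bilinear form that vanishes on the diagonal is
    zero.\<close>
  have "second_derivative k y0 (u + w) (u + w) =
      second_derivative k y0 u u + second_derivative k y0 u w
      + (second_derivative k y0 w u + second_derivative k y0 w w)"
    using linear_add[OF linear_second_derivative_left[OF assms(2,3)]]
      linear_add[OF linear_second_derivative_right[OF assms(1-3)]] by simp
  then show "second_derivative k y0 u w = 0"
    using diag second_derivative_commute_real[OF assms(1-3), of u w] by simp
qed

section \<open>Annihilated quadratic maps in the plane and the algebraic core of the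
  argument\<close>

section \<open>The algebra of second and third derivatives\<close>

text \<open>The values at the opposite points (1, 0) and (-1, 0) are negatives of each other, so the
  intermediate value theorem applies on the half circle between them.\<close>

lemma odd_function_has_zero_on_circle:
  fixes P :: "real \<Rightarrow> real \<Rightarrow> real"
  assumes "continuous_on UNIV (\<lambda>t. P (cos t) (sin t))" "\<And>x y. P (- x) (- y) = - P x y"
  shows "\<exists>x y. (x, y) \<noteq> (0, 0) \<and> P x y = 0"
proof -
  let ?f = "\<lambda>t. P (cos t) (sin t)"
  have f: "?f pi = - ?f 0" using assms(2)[of 1 0] by simp
  have "\<exists>t. ?f t = 0"
  proof (cases "?f 0 \<le> 0")
    case True
    then show ?thesis using IVT'[of ?f 0 0 pi] f assms(1) continuous_on_subset by fastforce
  next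
    case False
    then show ?thesis using IVT2'[of ?f pi 0 0] f assms(1) continuous_on_subset by fastforce
  qed
  then obtain t where "?f t = 0" by blast
  moreover have "(cos t, sin t) \<noteq> (0, 0)" using sin_cos_squared_add[of t] by force
  ultimately show ?thesis by blast
qed

text \<open>If \<open>k\<close> is not 0, then \<open>\<mu>\<close> at the coordinates of
  \<open>k\<close> is positive on \<open>k\<close>, hence also at nearby points. The quadratic form
  in front must vanish near (k1, k2), thus everywhere, which contradicts that \<open>p\<close> and
  \<open>q\<close> are not both 0.\<close>

lemma quadratic_form_annihilated_eq_0:
  fixes \<mu> :: "real \<Rightarrow> real \<Rightarrow> 'v::real_vector \<Rightarrow> real"
  assumes cont: "\<And>\<xi>. continuous_on (UNIV - {(0, 0)}) (\<lambda>(x, y). \<mu> x y \<xi>)"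
    and pos: "\<And>x y. (x, y) \<noteq> (0, 0) \<Longrightarrow> \<mu> x y (x *\<^sub>R l1 + y *\<^sub>R l2) > 0"
    and k: "k = k1 *\<^sub>R l1 + k2 *\<^sub>R l2"
    and zero: "\<And>x y. (x, y) \<noteq> (0, 0) \<Longrightarrow> ((a * x\<^sup>2 - b * y\<^sup>2) * p + x * y * q) * \<mu> x y k = 0"
    and "a \<noteq> 0" "(p, q) \<noteq> (0, 0)"
  shows "k = 0"
proof (rule ccontr)
  assume "k \<noteq> 0"
  then have k0: "(k1, k2) \<noteq> (0, 0)" using k by auto
  define P where "P = (\<lambda>x y. (a * x\<^sup>2 - b * y\<^sup>2) * p + x * y * q)"
  define D where "D = (\<lambda>(x, y). \<mu> x y k)"
  have "isCont D (k1, k2)"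
    using cont[of k] k0 continuous_on_eq_continuous_at[of "UNIV - {(0, 0)}" D]
    by (simp add: D_def open_delete)
  moreover have Dk: "D (k1, k2) > 0" using pos[OF k0] k by (simp add: D_def)
  ultimately obtain d where d: "d > 0" "\<And>z. dist z (k1, k2) < d \<Longrightarrow> D z > 0"
    using continuous_at_eps_delta[of "(k1, k2)" D] unfolding dist_real_def
    by (smt (verit, best))
  have Pnear: "P x y = 0" if "dist (x, y) (k1, k2) < d" for x y
  proof (cases "(x, y) = (0, 0)")
    case True
    then show ?thesis by (simp add: P_def)
  next
    case False
    then show ?thesis using zero[OF False] d(2)[OF that] by (auto simp: P_def D_def)
  qed
  have "P u v = 0" for u v
  proof -
    define e where "e = d / (2 * (\<bar>u\<bar> + \<bar>v\<bar> + 1))"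
    have "e > 0" using d(1) by (simp add: e_def)
    have "e * (\<bar>u\<bar> + \<bar>v\<bar>) < e * (2 * (\<bar>u\<bar> + \<bar>v\<bar> + 1))"
      using \<open>e > 0\<close> by (intro mult_strict_left_mono) auto
    also have "\<dots> = d" by (simp add: e_def)
    finally have e: "\<bar>e * u\<bar> + \<bar>e * v\<bar> < d" using \<open>e > 0\<close> by (simp add: abs_mult algebra_simps)
    have near: "dist (k1 + s * u, k2 + s * v) (k1, k2) < d" if "\<bar>s\<bar> = e" for s
    proof -
      have "dist (k1 + s * u, k2 + s * v) (k1, k2) = sqrt ((s * u)\<^sup>2 + (s * v)\<^sup>2)"
        by (simp add: dist_Pair_Pair dist_real_def)
      also have "\<dots> \<le> \<bar>s * u\<bar> + \<bar>s * v\<bar>" by (rule sqrt_sum_squares_le_sum_abs)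
      also have "\<dots> = \<bar>e * u\<bar> + \<bar>e * v\<bar>" using that \<open>e > 0\<close> by (simp add: abs_mult)
      finally show ?thesis using e by simp
    qed
    \<comment> \<open>The symmetric second difference of a quadratic form recovers the form itself,
      so vanishing near one point gives vanishing at every (u, v).\<close>
    have "P (k1 + e * u) (k2 + e * v) = 0" "P (k1 - e * u) (k2 - e * v) = 0" "P k1 k2 = 0"
      using Pnear[OF near[of e]] Pnear[OF near[of "- e"]] Pnear[of k1 k2] \<open>e > 0\<close> d(1) by auto
    then have "P (k1 + e * u) (k2 + e * v) + P (k1 - e * u) (k2 - e * v) - 2 * P k1 k2 = 0" by simp
    moreover have "P (k1 + e * u) (k2 + e * v) + P (k1 - e * u) (k2 - e * v) - 2 * P k1 k2
        = 2 * e\<^sup>2 * P u v"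
      unfolding P_def by (simp add: power2_eq_square algebra_simps)
    ultimately show ?thesis using \<open>e > 0\<close> by simp
  qed
  from this[of 1 0] this[of 1 1] have "p = 0" "q = 0" using \<open>a \<noteq> 0\<close> by (auto simp: P_def)
  with \<open>(p, q) \<noteq> (0, 0)\<close> show False by simp
qed

text \<open>
  The cubic \<open>v \<wedge> Q(v)\<close> has a real zero \<open>v\<noteq>0\<close> and there \<open>Q(v)\<close>, being a multiple of \<open>v\<close> annihilated
  by \<open>\<mu>\<close>, vanishes. So \<open>c\<close> and \<open>g\<close> are proportional to one vector \<open>k\<close>, which is then annihilated by
  \<open>\<mu>\<close> at generic points, hence also at \<open>k\<close> itself.
\<close>

lemma quadratic_map_annihilated_eq_0:
  fixes \<mu> :: "real \<Rightarrow> real \<Rightarrow> 'v::real_vector \<Rightarrow> real"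
  assumes lin: "\<And>x y. (x, y) \<noteq> (0, 0) \<Longrightarrow> linear (\<mu> x y)"
    and cont: "\<And>\<xi>. continuous_on (UNIV - {(0, 0)}) (\<lambda>(x, y). \<mu> x y \<xi>)"
    and pos: "\<And>x y. (x, y) \<noteq> (0, 0) \<Longrightarrow> \<mu> x y (x *\<^sub>R l1 + y *\<^sub>R l2) > 0"
    and c: "c = c1 *\<^sub>R l1 + c2 *\<^sub>R l2" and g: "g = g1 *\<^sub>R l1 + g2 *\<^sub>R l2"
    and zero: "\<And>x y. (x, y) \<noteq> (0, 0) \<Longrightarrow> \<mu> x y ((a * x\<^sup>2 - b * y\<^sup>2) *\<^sub>R c + (x * y) *\<^sub>R g) = 0"
    and "a \<noteq> 0" "b \<noteq> 0"
  shows "c = 0 \<and> g = 0"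
proof -
  define Q where "Q = (\<lambda>x y. (a * x\<^sup>2 - b * y\<^sup>2) *\<^sub>R c + (x * y) *\<^sub>R g)"
  define Q1 where "Q1 = (\<lambda>x y. (a * x\<^sup>2 - b * y\<^sup>2) * c1 + (x * y) * g1)"
  define Q2 where "Q2 = (\<lambda>x y. (a * x\<^sup>2 - b * y\<^sup>2) * c2 + (x * y) * g2)"
  have Q: "Q x y = Q1 x y *\<^sub>R l1 + Q2 x y *\<^sub>R l2" for x y
    unfolding Q_def Q1_def Q2_def c g by (simp add: scaleR_add_right scaleR_add_left)
  have mult: "(s * \<mu> x y z = 0) = (\<mu> x y (s *\<^sub>R z) = 0)" if "(x, y) \<noteq> (0, 0)" for s x y z
    using linear_scale[OF lin[OF that]] by simp
  obtain x y where xy: "(x, y) \<noteq> (0, 0)" "x * Q2 x y - y * Q1 x y = 0"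
  proof -
    have "\<exists>x y. (x, y) \<noteq> (0, 0) \<and> x * Q2 x y - y * Q1 x y = 0"
      by (rule odd_function_has_zero_on_circle) (auto intro!: continuous_intros simp: Q1_def Q2_def algebra_simps)
    then show ?thesis using that by blast
  qed
  \<comment> \<open>At a zero of the cubic, (Q1, Q2) is parallel to (x, y); \<open>s\<close> is the
    factor, read off from a nonzero coordinate.\<close>
  define s where "s = (if x \<noteq> 0 then Q1 x y / x else Q2 x y / y)"
  have "Q1 x y = s * x" "Q2 x y = s * y" using xy by (auto simp: s_def field_simps)
  then have Qs: "Q x y = s *\<^sub>R (x *\<^sub>R l1 + y *\<^sub>R l2)" unfolding Q by (simp add: scaleR_add_right)
  \<comment> \<open>\<open>\<mu>\<close> annihilates the value of \<open>Q\<close> but is positive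
    on the vector of which that value is the multiple by \<open>s\<close>.\<close>
  have "s = 0"
    using Qs zero[OF xy(1)] pos[OF xy(1)] mult[OF xy(1), of s "x *\<^sub>R l1 + y *\<^sub>R l2"]
    unfolding Q_def by simp
  then have Q0: "(a * x\<^sup>2 - b * y\<^sup>2) *\<^sub>R c + (x * y) *\<^sub>R g = 0"
    using Qs \<open>s = 0\<close> unfolding Q_def by simp
  show ?thesis
  proof (cases "c = 0")
    case True
    have "g = 0"
    proof (rule quadratic_form_annihilated_eq_0[OF cont pos g _ \<open>a \<noteq> 0\<close>])
      show "((a * x\<^sup>2 - b * y\<^sup>2) * 0 + x * y * 1) * \<mu> x y g = 0" if "(x, y) \<noteq> (0, 0)" for x y
        using zero[OF that] mult[OF that, of "x * y" g] True by simp
    qed auto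
    with True show ?thesis by simp
  next
    case False
    \<comment> \<open>On an axis only the term with \<open>c\<close> survives, and its coefficient
      there is nonzero because \<open>a\<close> and \<open>b\<close> are. Off the axes
      \<open>Q = 0\<close> can be solved for \<open>g\<close> as a multiple of
      \<open>c\<close>.\<close>
    have "x * y \<noteq> 0"
    proof
      assume "x * y = 0"
      have "(a * x\<^sup>2 - b * y\<^sup>2) *\<^sub>R c = 0" using Q0 unfolding \<open>x * y = 0\<close> by simp
      then have "a * x\<^sup>2 - b * y\<^sup>2 = 0" using False unfolding scaleR_eq_0_iff by simp
      then show False using \<open>x * y = 0\<close> xy(1) \<open>a \<noteq> 0\<close> \<open>b \<noteq> 0\<close> by auto
    qed
    define \<kappa> where "\<kappa> = - (a * x\<^sup>2 - b * y\<^sup>2) / (x * y)"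
    have "(x * y) *\<^sub>R g = (- (a * x\<^sup>2 - b * y\<^sup>2)) *\<^sub>R c"
      using Q0 unfolding scaleR_minus_left eq_neg_iff_add_eq_0 by (simp only: add.commute)
    then have "(1 / (x * y)) *\<^sub>R ((x * y) *\<^sub>R g) = (1 / (x * y)) *\<^sub>R ((- (a * x\<^sup>2 - b * y\<^sup>2)) *\<^sub>R c)"
      by simp
    then have gk: "g = \<kappa> *\<^sub>R c" using \<open>x * y \<noteq> 0\<close> by (simp add: \<kappa>_def)
    have "c = 0"
    proof (rule quadratic_form_annihilated_eq_0[OF cont pos c _ \<open>a \<noteq> 0\<close>])
      show "((a * x\<^sup>2 - b * y\<^sup>2) * 1 + x * y * \<kappa>) * \<mu> x y c = 0" if "(x, y) \<noteq> (0, 0)" for x y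
        using zero[OF that] unfolding mult[OF that] gk by (simp add: scaleR_add_left)
    qed auto
    with False show ?thesis by simp
  qed
qed

text \<open>Diagonalization in the plane: polarization provides a vector with \<open>h e1 e1\<close>
  nonzero, and \<open>e2\<close> spans the kernel of \<open>h e1\<close>. The last two conclusions
  express that the two vectors form a basis.\<close>

lemma orthogonal_basis_of_nondegenerate_form:
  fixes h :: "'e::euclidean_space \<Rightarrow> 'e \<Rightarrow> real"
  assumes dim: "DIM('e) = 2"
    and lin: "\<And>v. linear (h v)" and sym: "\<And>u v. h u v = h v u"
    and nondeg: "\<And>u. u \<noteq> 0 \<Longrightarrow> \<exists>w. h u w \<noteq> 0"
  obtains e1 e2 where "h e1 e1 \<noteq> 0" "h e2 e2 \<noteq> 0" "h e1 e2 = 0"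
    "\<And>v. \<exists>x y. v = x *\<^sub>R e1 + y *\<^sub>R e2"
    "\<And>x y. (x, y) \<noteq> (0, 0) \<Longrightarrow> x *\<^sub>R e1 + y *\<^sub>R e2 \<noteq> 0"
proof -
  have add: "h u (v + w) = h u v + h u w" and scale: "h u (r *\<^sub>R w) = r * h u w" for u v w r
    using linear_add[OF lin] linear_scale[OF lin] by auto
  have add': "h (v + w) u = h v u + h w u" and scale': "h (r *\<^sub>R w) u = r * h w u" for u v w r
    using add scale sym by metis+
  obtain e1 where e1: "h e1 e1 \<noteq> 0"
  proof (rule ccontr)
    assume "\<not> thesis"
    then have z: "h u u = 0" for u using that by blast
    have "h u w = 0" for u w using z[of "u + w"] z[of u] z[of w] sym[of u w] by (simp add: add add')
    moreover obtain u :: 'e where "u \<noteq> 0" using nonempty_Basis nonzero_Basis by blast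
    ultimately show False using nondeg by blast
  qed
  obtain i j :: 'e where ij: "Basis = {i, j}" "i \<noteq> j" using dim card_2_iff by metis
  \<comment> \<open>The coordinates of \<open>h e1\<close> turned by a right angle, so that
    \<open>h e1\<close> vanishes on this vector.\<close>
  define e2 where "e2 = h e1 j *\<^sub>R i - h e1 i *\<^sub>R j"
  have orth: "h e1 e2 = 0"
    unfolding e2_def using linear_diff[OF lin] by (simp add: scale)
  have "i \<in> Basis" "j \<in> Basis" using ij(1) by auto
  then have ip: "i \<bullet> i = 1" "j \<bullet> j = 1" "i \<bullet> j = 0" "j \<bullet> i = 0"
    using ij(2) by (auto simp: inner_Basis)
  have "e2 \<noteq> 0"
  proof
    assume "e2 = 0"
    then have "e2 \<bullet> i = 0" "e2 \<bullet> j = 0" by auto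
    then have hij: "h e1 i = 0" "h e1 j = 0" using ip by (auto simp: e2_def inner_diff_left)
    have e1_eq: "(e1 \<bullet> i) *\<^sub>R i + (e1 \<bullet> j) *\<^sub>R j = e1"
      using euclidean_representation[of e1] ij(2) unfolding ij(1) by simp
    have "h e1 ((e1 \<bullet> i) *\<^sub>R i + (e1 \<bullet> j) *\<^sub>R j) = 0" by (simp add: add scale hij)
    with e1 show False unfolding e1_eq by simp
  qed
  have indep: "x = 0 \<and> y = 0" if "x *\<^sub>R e1 + y *\<^sub>R e2 = 0" for x y
  proof -
    have "h e1 (x *\<^sub>R e1 + y *\<^sub>R e2) = x * h e1 e1" using orth by (simp add: add scale)
    then have "x = 0" using e1 that linear_0[OF lin] by simp
    then show ?thesis using that \<open>e2 \<noteq> 0\<close> by simp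
  qed
  have span: "\<exists>x y. v = x *\<^sub>R e1 + y *\<^sub>R e2" for v
  proof -
    have "e1 \<noteq> e2" using e1 orth by auto
    have "independent {e1, e2}"
    proof (rule independent_insertI)
      show "e1 \<notin> span {e2}"
      proof
        assume "e1 \<in> span {e2}"
        then obtain r where "e1 = r *\<^sub>R e2" by (auto simp: span_singleton)
        then show False using indep[of 1 "- r"] by simp
      qed
      show "independent {e2}" using \<open>e2 \<noteq> 0\<close> by simp
    qed
    from card_ge_dim_independent[OF subset_UNIV this] have "UNIV \<subseteq> span {e1, e2}"
      using \<open>e1 \<noteq> e2\<close> dim by (simp add: dim_UNIV)
    then have "v \<in> span {e1, e2}" by blast
    then obtain x where "v - x *\<^sub>R e1 \<in> span {e2}" using span_breakdown_eq[of v e1 "{e2}"] by blast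
    then obtain y where "v - x *\<^sub>R e1 = y *\<^sub>R e2" by (auto simp: span_singleton)
    then show ?thesis by (metis add.commute diff_add_cancel)
  qed
  \<comment> \<open>Otherwise \<open>e2\<close> would be orthogonal to both basis vectors, hence to
    everything.\<close>
  have "h e2 e2 \<noteq> 0"
  proof
    assume 0: "h e2 e2 = 0"
    obtain w where w: "h e2 w \<noteq> 0" using nondeg[OF \<open>e2 \<noteq> 0\<close>] by blast
    obtain x y where "w = x *\<^sub>R e1 + y *\<^sub>R e2" using span by blast
    then show False using w 0 orth sym[of e1 e2] by (simp add: add scale)
  qed
  then show thesis using that[of e1 e2] e1 orth span indep by blast
qed

text \<open>Here \<open>L\<close>, \<open>B\<close>, \<open>T\<close> stand for the first three
  derivatives at the point of the map read in flat coordinates, and \<open>\<nu> v\<close>,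
  \<open>q v\<close> for the first two derivatives of \<open>\<Phi>\<^sup>2\<close> at
  \<open>L v\<close>. \<open>E1\<close> and \<open>E2\<close> say that \<open>\<Phi>\<^sup>2\<close>
  of the derivative in the fixed direction \<open>v\<close> is stationary to second order.\<close>

lemma normal_form_degenerate:
  fixes L :: "'e::euclidean_space \<Rightarrow> 'v::euclidean_space"
    and B :: "'e \<Rightarrow> 'e \<Rightarrow> 'v" and T :: "'e \<Rightarrow> 'e \<Rightarrow> 'e \<Rightarrow> 'v"
    and \<pi> :: "'v \<Rightarrow> real" and \<nu> :: "'e \<Rightarrow> 'v \<Rightarrow> real" and q :: "'e \<Rightarrow> 'v \<Rightarrow> 'v \<Rightarrow> real"
  assumes dim: "DIM('e) = 2" and L: "linear L"
    and B: "\<And>v. linear (B v)" "\<And>u v. B u v = B v u"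
    and T: "\<And>v w. linear (T v w)" "\<And>u v w. T u v w = T v u w" "\<And>u v w. T u v w = T u w v"
    and \<pi>: "linear \<pi>" "range L = {x. \<pi> x = 0}"
    and \<nu>_lin: "\<And>v. v \<noteq> 0 \<Longrightarrow> linear (\<nu> v)"
    and \<nu>_cont: "\<And>\<xi>. continuous_on (UNIV - {0}) (\<lambda>v. \<nu> v \<xi>)"
    and \<nu>_pos: "\<And>v. v \<noteq> 0 \<Longrightarrow> \<nu> v (L v) > 0"
    and E1: "\<And>v w. v \<noteq> 0 \<Longrightarrow> \<nu> v (B v w) = 0"
    and E2: "\<And>v w u. v \<noteq> 0 \<Longrightarrow> q v (B v w) (B v u) + \<nu> v (T v w u) = 0"
    and q: "\<And>v x. v \<noteq> 0 \<Longrightarrow> q v 0 x = 0" "\<And>v x. v \<noteq> 0 \<Longrightarrow> x \<noteq> 0 \<Longrightarrow> q v x x > 0"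
  shows "\<exists>u. u \<noteq> 0 \<and> (\<forall>w. \<pi> (B u w) = 0)"
proof (rule ccontr)
  assume "\<not> ?thesis"
  then have nondeg: "\<exists>w. \<pi> (B u w) \<noteq> 0" if "u \<noteq> 0" for u using that by blast
  have linh: "linear (\<lambda>w. \<pi> (B v w))" for v
    using linear_compose[OF B(1) \<pi>(1)] by (simp add: o_def)
  obtain e1 e2 where h: "\<pi> (B e1 e1) \<noteq> 0" "\<pi> (B e2 e2) \<noteq> 0" "\<pi> (B e1 e2) = 0"
    and span: "\<And>v. \<exists>x y. v = x *\<^sub>R e1 + y *\<^sub>R e2"
    and ne: "\<And>x y. (x, y) \<noteq> (0, 0) \<Longrightarrow> x *\<^sub>R e1 + y *\<^sub>R e2 \<noteq> 0"
    by (rule orthogonal_basis_of_nondegenerate_form[of "\<lambda>u w. \<pi> (B u w)"])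
      (use dim linh B(2) nondeg in auto)
  define a b where "a = \<pi> (B e1 e1)" and "b = \<pi> (B e2 e2)"
  have ab: "a \<noteq> 0" "b \<noteq> 0" using h by (auto simp: a_def b_def)
  note \<pi>s = linear_add[OF \<pi>(1)] linear_diff[OF \<pi>(1)] linear_scale[OF \<pi>(1)] linear_0[OF \<pi>(1)]
  note Bs = linear_add[OF B(1)] linear_diff[OF B(1)] linear_scale[OF B(1)]
  have Bs': "B (x *\<^sub>R u + y *\<^sub>R v) w = x *\<^sub>R B u w + y *\<^sub>R B v w" for x y u v w
    unfolding B(2)[of _ w] by (simp add: Bs)
  have Ts: "T u (x *\<^sub>R v + y *\<^sub>R v') w = x *\<^sub>R T u v w + y *\<^sub>R T u v' w" for x y u v v' w
    unfolding T(3)[of u _ w] by (simp add: linear_add[OF T(1)] linear_scale[OF T(1)])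
  have Ts': "T (x *\<^sub>R v + y *\<^sub>R v') u w = x *\<^sub>R T v u w + y *\<^sub>R T v' u w" for x y u v v' w
    unfolding T(2)[of _ u w] by (rule Ts)
  have tangent: "\<exists>z1 z2. \<xi> = z1 *\<^sub>R L e1 + z2 *\<^sub>R L e2" if "\<pi> \<xi> = 0" for \<xi>
  proof -
    have "\<xi> \<in> range L" using that \<pi>(2) by simp
    then obtain z where "\<xi> = L z" by (rule rangeE)
    moreover obtain z1 z2 where "z = z1 *\<^sub>R e1 + z2 *\<^sub>R e2" using span by blast
    ultimately have "\<xi> = z1 *\<^sub>R L e1 + z2 *\<^sub>R L e2" by (simp add: linear_add[OF L] linear_scale[OF L])
    then show ?thesis by (intro exI)
  qed
  define \<mu> where "\<mu> = (\<lambda>x y. \<nu> (x *\<^sub>R e1 + y *\<^sub>R e2))"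
  have annih: "c = 0 \<and> g = 0"
    if tan: "\<pi> c = 0" "\<pi> g = 0"
      and ann: "\<And>x y. (x, y) \<noteq> (0, 0) \<Longrightarrow> \<mu> x y ((a * x\<^sup>2 - b * y\<^sup>2) *\<^sub>R c + (x * y) *\<^sub>R g) = 0" for c g
  proof -
    obtain c1 c2 where c: "c = c1 *\<^sub>R L e1 + c2 *\<^sub>R L e2" using tangent[OF tan(1)] by blast
    obtain g1 g2 where g: "g = g1 *\<^sub>R L e1 + g2 *\<^sub>R L e2" using tangent[OF tan(2)] by blast
    show ?thesis
    proof (rule quadratic_map_annihilated_eq_0[where \<mu> = \<mu>, OF _ _ _ c g _ ab])
      show "\<mu> x y ((a * x\<^sup>2 - b * y\<^sup>2) *\<^sub>R c + (x * y) *\<^sub>R g) = 0" if "(x, y) \<noteq> (0, 0)" for x y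
        by (rule ann[OF that])
      show "linear (\<mu> x y)" if "(x, y) \<noteq> (0, 0)" for x y
        unfolding \<mu>_def by (rule \<nu>_lin[OF ne[OF that]])
      show "\<mu> x y (x *\<^sub>R L e1 + y *\<^sub>R L e2) > 0" if "(x, y) \<noteq> (0, 0)" for x y
        using \<nu>_pos[OF ne[OF that]] unfolding \<mu>_def by (simp add: linear_add[OF L] linear_scale[OF L])
      show "continuous_on (UNIV - {(0, 0)}) (\<lambda>(x, y). \<mu> x y \<xi>)" for \<xi>
      proof -
        have "continuous_on (UNIV - {(0, 0)}) (\<lambda>z::real \<times> real. fst z *\<^sub>R e1 + snd z *\<^sub>R e2)"
          by (intro continuous_intros)
        from continuous_on_compose2[OF \<nu>_cont[of \<xi>] this] show ?thesis
          using ne by (force simp: \<mu>_def split_def)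
      qed
    qed
  qed
  \<comment> \<open>In the diagonalizing basis, (b y, -a x) is the direction orthogonal to (x, y)
    for the second fundamental form. Therefore \<open>B\<close> of the pair is tangent, and
    \<open>E1\<close> makes it an annihilated quadratic map.\<close>
  have quad: "B (x *\<^sub>R e1 + y *\<^sub>R e2) ((b * y) *\<^sub>R e1 - (a * x) *\<^sub>R e2)
      = (a * x\<^sup>2 - b * y\<^sup>2) *\<^sub>R (- B e1 e2) + (x * y) *\<^sub>R (b *\<^sub>R B e1 e1 - a *\<^sub>R B e2 e2)" for x y
    unfolding Bs' using B(2)[of e2 e1] by (simp add: Bs algebra_simps power2_eq_square)
  have "- B e1 e2 = 0 \<and> b *\<^sub>R B e1 e1 - a *\<^sub>R B e2 e2 = 0"
  proof (rule annih)
    show "\<pi> (- B e1 e2) = 0" using h(3) linear_neg[OF \<pi>(1)] by simp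
    show "\<pi> (b *\<^sub>R B e1 e1 - a *\<^sub>R B e2 e2) = 0" by (simp add: \<pi>s a_def b_def)
  qed (use E1 ne quad \<mu>_def in metis)
  then have B12: "B e1 e2 = 0" and eq: "b *\<^sub>R B e1 e1 = a *\<^sub>R B e2 e2" by auto
  \<comment> \<open>The common direction of all values of \<open>B\<close>, scaled so that
    \<open>\<pi> n = 1\<close>; thus \<open>B\<close> is the second fundamental form times
    \<open>n\<close>.\<close>
  define n where "n = (1 / a) *\<^sub>R B e1 e1"
  have B11: "B e1 e1 = a *\<^sub>R n" using ab by (simp add: n_def)
  have "a *\<^sub>R B e2 e2 = a *\<^sub>R (b *\<^sub>R n)" using eq[symmetric] by (simp add: B11 mult.commute)
  then have B22: "B e2 e2 = b *\<^sub>R n" by (rule scaleR_left_imp_eq[OF ab(1)])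
  have \<pi>n: "\<pi> n = 1" using ab by (simp add: n_def \<pi>s a_def)
  \<comment> \<open>Pairing v with \<open>e1\<close> and \<open>e2\<close> under \<open>B\<close>
    gives the multiples \<open>x a\<close> and \<open>y b\<close> of \<open>n\<close>, not both
    zero; \<open>E1\<close> kills both.\<close>
  have \<mu>n: "\<mu> x y n = 0" if xy: "(x, y) \<noteq> (0, 0)" for x y
  proof -
    have "B (x *\<^sub>R e1 + y *\<^sub>R e2) e1 = (x * a) *\<^sub>R n" "B (x *\<^sub>R e1 + y *\<^sub>R e2) e2 = (y * b) *\<^sub>R n"
      unfolding Bs' using B(2)[of e2 e1] by (simp_all add: B11 B12 B22)
    with E1[OF ne[OF xy], of e1] E1[OF ne[OF xy], of e2]
    have "x * a * \<mu> x y n = 0" "y * b * \<mu> x y n = 0"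
      using linear_scale[OF \<nu>_lin[OF ne[OF xy]]] by (simp_all add: \<mu>_def)
    then show ?thesis using ab xy by auto
  qed
  \<comment> \<open>Projection to the tangent plane along \<open>n\<close>. It does not change the
    values of \<open>\<mu>\<close>, since these vanish on \<open>n\<close>.\<close>
  define pr where "pr = (\<lambda>\<xi>. \<xi> - \<pi> \<xi> *\<^sub>R n)"
  have pr: "\<pi> (pr \<xi>) = 0" for \<xi> by (simp add: pr_def \<pi>s \<pi>n)
  have pr_lin: "pr (s *\<^sub>R \<xi> + t *\<^sub>R \<eta>) = s *\<^sub>R pr \<xi> + t *\<^sub>R pr \<eta>" for s t \<xi> \<eta>
    by (simp add: pr_def \<pi>s algebra_simps)
  have \<mu>_pr: "\<mu> x y (pr \<xi>) = \<mu> x y \<xi>" if "(x, y) \<noteq> (0, 0)" for x y \<xi>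
    using \<mu>n[OF that] \<nu>_lin[OF ne[OF that]]
    by (simp add: pr_def \<mu>_def linear_diff linear_scale)
  have prT: "pr (- T e1 e2 u) = 0 \<and> pr (b *\<^sub>R T e1 e1 u + (- a) *\<^sub>R T e2 e2 u) = 0" for u
  proof (rule annih[OF pr pr])
    fix x y :: real assume xy: "(x, y) \<noteq> (0, 0)"
    let ?v = "x *\<^sub>R e1 + y *\<^sub>R e2" and ?w = "(b * y) *\<^sub>R e1 + (- (a * x)) *\<^sub>R e2"
    have "T ?v ?w u = (a * x\<^sup>2 - b * y\<^sup>2) *\<^sub>R (- T e1 e2 u)
        + (x * y) *\<^sub>R (b *\<^sub>R T e1 e1 u + (- a) *\<^sub>R T e2 e2 u)"
      unfolding Ts Ts' using T(2)[of e2 e1] by (simp add: algebra_simps power2_eq_square)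
    \<comment> \<open>The two directions are orthogonal for the second fundamental form and
      \<open>B\<close> is that form times \<open>n\<close>. Hence the quadratic term of
      \<open>E2\<close> drops out and only the third derivative remains.\<close>
    moreover have "B ?v ?w = 0"
      unfolding Bs' using B(2)[of e2 e1] by (simp add: Bs B11 B12 B22 linear_neg[OF B(1)])
    then have "\<nu> ?v (T ?v ?w u) = 0"
      using E2[OF ne[OF xy], of ?w u] q(1)[OF ne[OF xy]] by simp
    ultimately show "\<mu> x y ((a * x\<^sup>2 - b * y\<^sup>2) *\<^sub>R pr (- T e1 e2 u)
        + (x * y) *\<^sub>R pr (b *\<^sub>R T e1 e1 u + (- a) *\<^sub>R T e2 e2 u)) = 0"
      unfolding pr_lin[symmetric] \<mu>_pr[OF xy] by (simp add: \<mu>_def)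
  qed
  \<comment> \<open>By symmetry this is the case \<open>u = e2\<close> of the mixed entry. The case
    \<open>u = e1\<close> then makes \<open>T e1 e1 e1\<close> a multiple of \<open>n\<close> too,
    so \<open>E2\<close> along \<open>e1\<close> leaves only \<open>q e1\<close> at
    \<open>B e1 e1\<close>, which is positive.\<close>
  have "pr (T e2 e2 e1) = 0"
    using prT[of e2] pr_lin[of "-1" "T e1 e2 e2" 0 0] T(2)[of e1 e2 e2] T(3)[of e2 e1 e2] by simp
  then have "pr (T e1 e1 e1) = 0"
    using prT[of e1] ab unfolding pr_lin by simp
  then have "\<nu> e1 (T e1 e1 e1) = 0"
    using \<mu>_pr[of 1 0 "T e1 e1 e1"] linear_0[OF \<nu>_lin[OF ne[of 1 0]]] by (simp add: \<mu>_def)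
  then have "q e1 (B e1 e1) (B e1 e1) = 0" using E2[of e1 e1 e1] ne[of 1 0] by simp
  moreover have "B e1 e1 \<noteq> 0" using h(1) \<pi>s(4) by auto
  ultimately show False using q(2)[of e1 "B e1 e1"] ne[of 1 0] by simp
qed

section \<open>From the ratio estimate of norms to equations between derivatives\<close>

section \<open>Isometry to second order\<close>

lemma smooth_on_power2_minkowski:
  assumes "banach_minkowski_norm \<Phi>"
  shows "smooth_on (UNIV - {0}) (\<lambda>x. (\<Phi> x)\<^sup>2)"
  using assms smooth_on_power2[of "UNIV - {0}" \<Phi>] unfolding banach_minkowski_norm_def
  by (simp add: open_delete)

text \<open>Euler's identity for a function homogeneous of degree two, obtained by differentiating
  along the ray through \<open>z\<close>.\<close>

lemma minkowski_euler:
  assumes "banach_minkowski_norm \<Phi>" "z \<noteq> 0"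
  shows "frechet_derivative (\<lambda>x. (\<Phi> x)\<^sup>2) (at z) z = 2 * (\<Phi> z)\<^sup>2"
proof -
  let ?\<Psi> = "\<lambda>x. (\<Phi> x)\<^sup>2"
  have hom: "\<Phi> (t *\<^sub>R x) = t * \<Phi> x" if "0 \<le> t" for t x
    using assms that by (simp add: banach_minkowski_norm_def minkowski_norm_def)
  have "((\<lambda>t. ?\<Psi> (z + t *\<^sub>R z)) has_real_derivative frechet_derivative ?\<Psi> (at (z + 0 *\<^sub>R z)) z) (at 0)"
    by (rule smooth_on_has_real_derivative_line[OF smooth_on_power2_minkowski[OF assms(1)]])
      (use assms(2) in simp)
  moreover have "((\<lambda>t. (1 + t)\<^sup>2 * ?\<Psi> z) has_real_derivative 2 * ?\<Psi> z) (at 0)"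
    by (auto intro!: derivative_eq_intros)
  then have "((\<lambda>t. ?\<Psi> (z + t *\<^sub>R z)) has_real_derivative 2 * ?\<Psi> z) (at 0)"
  proof (rule DERIV_cong_ev[THEN iffD1, rotated -1])
    \<comment> \<open>The norm is homogeneous for nonnegative factors only, so the factor
      \<open>1 + t\<close> has to stay positive.\<close>
    have "\<forall>\<^sub>F t::real in nhds 0. t \<in> {-1<..}" by (intro eventually_nhds_in_open) auto
    then show "\<forall>\<^sub>F t in nhds 0. (1 + t)\<^sup>2 * ?\<Psi> z = ?\<Psi> (z + t *\<^sub>R z)"
    proof eventually_elim
      case (elim t)
      have "z + t *\<^sub>R z = (1 + t) *\<^sub>R z" by (simp add: scaleR_add_left)
      then show ?case using hom[of "1 + t" z] elim by (simp add: power_mult_distrib)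
    qed
  qed auto
  ultimately show ?thesis using DERIV_unique by fastforce
qed

text \<open>Turns an estimate of the ratio of norms into one of the difference of squares: with
  \<open>s = r / n\<close> the latter is (s - 1)(s + 1) n^2. The minimum with 1 and
  \<open>d < 1\<close> keep |s + 1| at most 3, which the factor 3 in the bound absorbs.\<close>

lemma power2_near:
  fixes r n e d :: real
  assumes "n > 0" "e > 0" "d < 1" "0 \<le> d" "\<bar>r / n - 1\<bar> \<le> min 1 (e / (3 * n\<^sup>2)) * d\<^sup>2"
  shows "\<bar>r\<^sup>2 - n\<^sup>2\<bar> \<le> e * d\<^sup>2"
proof -
  define s where "s = r / n"
  have r: "r = s * n" using assms(1) by (simp add: s_def)
  have "d\<^sup>2 \<le> 1" using assms(3,4) by (simp add: power_le_one)
  have "\<bar>s - 1\<bar> \<le> min 1 (e / (3 * n\<^sup>2)) * d\<^sup>2" using assms(5) by (simp add: s_def)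
  also have "\<dots> \<le> 1 * 1" using \<open>d\<^sup>2 \<le> 1\<close> by (intro mult_mono) auto
  finally have "\<bar>s + 1\<bar> \<le> 3" by linarith
  have "\<bar>s - 1\<bar> \<le> e / (3 * n\<^sup>2) * d\<^sup>2"
    using assms(5) mult_right_mono[of "min 1 (e / (3 * n\<^sup>2))" "e / (3 * n\<^sup>2)" "d\<^sup>2"]
    by (simp add: s_def)
  then have "\<bar>s - 1\<bar> * \<bar>s + 1\<bar> \<le> (e / (3 * n\<^sup>2) * d\<^sup>2) * 3"
    using \<open>\<bar>s + 1\<bar> \<le> 3\<close> by (intro mult_mono) auto
  then have "(\<bar>s - 1\<bar> * \<bar>s + 1\<bar>) * n\<^sup>2 \<le> ((e / (3 * n\<^sup>2) * d\<^sup>2) * 3) * n\<^sup>2"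
    by (intro mult_right_mono) auto
  moreover have "(\<bar>s - 1\<bar> * \<bar>s + 1\<bar>) * n\<^sup>2 = \<bar>r\<^sup>2 - n\<^sup>2\<bar>"
  proof -
    have "r\<^sup>2 - n\<^sup>2 = (s - 1) * (s + 1) * n\<^sup>2" by (simp add: r power2_eq_square algebra_simps)
    then show ?thesis by (simp add: abs_mult)
  qed
  moreover have "((e / (3 * n\<^sup>2) * d\<^sup>2) * 3) * n\<^sup>2 = e * d\<^sup>2" using assms(1) by simp
  ultimately show ?thesis by simp
qed

text \<open>For fixed \<open>v\<close>, the squared norm of dH(v) is the constant
  \<open>n\<^sup>2\<close> up to o(|y - y0|^2). Its first two derivatives vanish at
  \<open>y0\<close>, and the chain rules express them through the derivatives of
  \<open>H\<close>.\<close>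

lemma
  fixes H :: "'e::euclidean_space \<Rightarrow> 'v::euclidean_space"
  assumes "open S" "smooth_on S H" "y0 \<in> S" and \<Phi>: "banach_minkowski_norm \<Phi>"
    and "n > 0" and v: "frechet_derivative H (at y0) v \<noteq> 0"
    and near: "\<And>e. e > 0 \<Longrightarrow>
      \<forall>\<^sub>F y in at y0. \<bar>\<Phi> (frechet_derivative H (at y) v) / n - 1\<bar> \<le> e * (dist y y0)\<^sup>2"
  shows first_order_isometric:
      "frechet_derivative (\<lambda>x. (\<Phi> x)\<^sup>2) (at (frechet_derivative H (at y0) v)) (second_derivative H y0 v w) = 0"
    and second_order_isometric:
      "second_derivative (\<lambda>x. (\<Phi> x)\<^sup>2) (frechet_derivative H (at y0) v)
         (second_derivative H y0 v w) (second_derivative H y0 v u)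
       + frechet_derivative (\<lambda>x. (\<Phi> x)\<^sup>2) (at (frechet_derivative H (at y0) v))
         (second_derivative (\<lambda>y. frechet_derivative H (at y) v) y0 w u) = 0"
proof -
  define D where "D = (\<lambda>y. frechet_derivative H (at y) v)"
  define \<Psi> where "\<Psi> = (\<lambda>x. (\<Phi> x)\<^sup>2)"
  \<comment> \<open>The squared norm is smooth away from the origin, so the derivative in direction
    \<open>v\<close> must stay nonzero.\<close>
  define S' where "S' = {y \<in> S. D y \<in> UNIV - {0}}"
  have D: "smooth_on S D" unfolding D_def by (rule smooth_on_frechet_derivative[OF assms(2)])
  have "open S'"
    unfolding S'_def using continuous_open_preimage[OF smooth_on_continuous_on[OF D] assms(1), of "UNIV - {0}"]
    by (simp add: vimage_def Int_def open_delete)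
  have "y0 \<in> S'" using assms(3) v by (simp add: S'_def D_def)
  have DS': "smooth_on S' D" by (rule smooth_on_subset[OF D]) (auto simp: S'_def)
  have img: "D ` S' \<subseteq> UNIV - {0}" by (auto simp: S'_def)
  have op: "open (UNIV - {0::'v})" by (simp add: open_delete)
  note \<Psi> = smooth_on_power2_minkowski[OF \<Phi>, folded \<Psi>_def]
  have k: "smooth_on S' (\<Psi> \<circ> D)" by (rule smooth_on_compose[OF \<open>open S'\<close> img \<Psi> DS'])
  have small: "\<forall>\<^sub>F y in at y0. \<bar>(\<Psi> \<circ> D) y - n\<^sup>2\<bar> \<le> e * (dist y y0)\<^sup>2" if "e > 0" for e
  proof -
    have "min 1 (e / (3 * n\<^sup>2)) > 0" using that \<open>n > 0\<close> by simp
    from near[OF this]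
    have "\<forall>\<^sub>F y in at y0. \<bar>\<Phi> (D y) / n - 1\<bar> \<le> min 1 (e / (3 * n\<^sup>2)) * (dist y y0)\<^sup>2"
      unfolding D_def .
    moreover have "\<forall>\<^sub>F y in at y0. dist y y0 < 1" unfolding eventually_at by (intro exI[of _ 1]) auto
    ultimately show ?thesis
    proof eventually_elim
      case (elim y)
      then show ?case using power2_near[OF \<open>n > 0\<close> that, of "dist y y0" "\<Phi> (D y)"] by (simp add: \<Psi>_def)
    qed
  qed
  have DD: "frechet_derivative D (at y0) w = second_derivative H y0 v w" for w
    using second_derivative_commute[OF assms(1-3), of v w] unfolding second_derivative_def D_def by simp
  have e: "frechet_derivative (\<Psi> \<circ> D) (at y0) w = frechet_derivative \<Psi> (at (D y0)) (second_derivative H y0 v w)"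
    using smooth_on_chain[OF DS' \<open>y0 \<in> S'\<close> \<Psi>, of w] img \<open>y0 \<in> S'\<close> unfolding DD by blast
  have e0: "frechet_derivative (\<Psi> \<circ> D) (at y0) w = 0"
    by (rule frechet_derivative_eq_0_of_small[OF \<open>open S'\<close> k \<open>y0 \<in> S'\<close> small])
  show "frechet_derivative (\<lambda>x. (\<Phi> x)\<^sup>2) (at (frechet_derivative H (at y0) v)) (second_derivative H y0 v w) = 0"
    using trans[OF e[symmetric] e0] unfolding \<Psi>_def D_def .
  have "second_derivative (\<Psi> \<circ> D) y0 w u = 0"
    by (rule second_derivative_eq_0_of_small[OF \<open>open S'\<close> k \<open>y0 \<in> S'\<close> small])
  then show "second_derivative (\<lambda>x. (\<Phi> x)\<^sup>2) (frechet_derivative H (at y0) v)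
         (second_derivative H y0 v w) (second_derivative H y0 v u)
       + frechet_derivative (\<lambda>x. (\<Phi> x)\<^sup>2) (at (frechet_derivative H (at y0) v))
         (second_derivative (\<lambda>y. frechet_derivative H (at y) v) y0 w u) = 0"
    unfolding second_derivative_compose[OF \<open>open S'\<close> \<open>y0 \<in> S'\<close> img op \<Psi> DS'] DD
    unfolding \<Psi>_def D_def .
qed

section \<open>Change of charts for maps and their derivatives\<close>

section \<open>Charts\<close>

lemma chart_openin: "is_chart X c \<Longrightarrow> openin X (fst c)"
  by (simp add: is_chart_def)

lemma chart_inj_on:
  assumes "is_chart X c"
  shows "inj_on (snd c) (fst c)"
proof -
  have "topspace (subtopology X (fst c)) = fst c"
    using openin_subset[OF chart_openin[OF assms]] by auto
  then show ?thesis
    using assms homeomorphic_imp_injective_map[of "subtopology X (fst c)"] unfolding is_chart_def by metis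
qed

lemma chart_inv_left: "is_chart X c \<Longrightarrow> x \<in> fst c \<Longrightarrow> chart_inv c (snd c x) = x"
  unfolding chart_inv_def by (rule inv_into_f_f[OF chart_inj_on])

lemma open_chart_image:
  assumes "is_chart X c" "openin X W"
  shows "open (snd c ` (fst c \<inter> W))"
proof -
  have "openin (top_of_set (snd c ` fst c)) (snd c ` (fst c \<inter> W))"
    using assms homeomorphic_imp_open_map openin_subtopology_Int2[OF assms(2)]
    unfolding is_chart_def open_map_def by blast
  then show ?thesis using assms(1) openin_open_eq unfolding is_chart_def by blast
qed

text \<open>On the overlap, the expression of \<open>h\<close> in \<open>c\<close> is its expression
  in \<open>d\<close> after the transition map, so both chain rules apply. The open set
  \<open>W\<close> allows \<open>h\<close> to be defined only locally, for instance as the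
  coordinate map of a third chart.\<close>

lemma
  fixes c d :: "('a, 'e::euclidean_space) chart"
  assumes c: "is_chart X c" and d: "is_chart X d" and cd: "smooth_transition c d"
    and W: "openin X W" and h: "smooth_on (snd d ` (fst d \<inter> W)) (h \<circ> chart_inv d)"
  shows chart_change_smooth_on: "smooth_on (snd c ` (fst c \<inter> (fst d \<inter> W))) (h \<circ> chart_inv c)"
    and chart_change_frechet_derivative: "x \<in> fst c \<Longrightarrow> x \<in> fst d \<Longrightarrow> x \<in> W \<Longrightarrow>
      frechet_derivative (h \<circ> chart_inv c) (at (snd c x)) u =
      frechet_derivative (h \<circ> chart_inv d) (at (snd d x))
        (frechet_derivative (snd d \<circ> chart_inv c) (at (snd c x)) u)"
    and chart_change_second_derivative: "x \<in> fst c \<Longrightarrow> x \<in> fst d \<Longrightarrow> x \<in> W \<Longrightarrow>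
      second_derivative (h \<circ> chart_inv c) (snd c x) u w =
      second_derivative (h \<circ> chart_inv d) (snd d x)
        (frechet_derivative (snd d \<circ> chart_inv c) (at (snd c x)) u)
        (frechet_derivative (snd d \<circ> chart_inv c) (at (snd c x)) w)
      + frechet_derivative (h \<circ> chart_inv d) (at (snd d x))
        (second_derivative (snd d \<circ> chart_inv c) (snd c x) u w)"
proof -
  let ?S = "snd c ` (fst c \<inter> (fst d \<inter> W))" and ?T = "snd d ` (fst d \<inter> W)"
  let ?t = "snd d \<circ> chart_inv c"
  have S: "open ?S" using openin_Int[OF chart_openin[OF d] W] by (rule open_chart_image[OF c])
  have T: "open ?T" by (rule open_chart_image[OF d W])
  have t: "smooth_on ?S ?t"
    using cd unfolding smooth_transition_def by (rule smooth_on_subset) blast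
  have img: "?t ` ?S \<subseteq> ?T" using chart_inv_left[OF c] by auto
  have comp: "smooth_on ?S ((h \<circ> chart_inv d) \<circ> ?t)" by (rule smooth_on_compose[OF S img h t])
  have eq: "((h \<circ> chart_inv d) \<circ> ?t) y = (h \<circ> chart_inv c) y" if "y \<in> ?S" for y
    using that chart_inv_left[OF c] chart_inv_left[OF d] by auto
  show "smooth_on ?S (h \<circ> chart_inv c)" by (rule smooth_on_cong[OF S eq comp])
  assume x: "x \<in> fst c" "x \<in> fst d" "x \<in> W"
  then have xS: "snd c x \<in> ?S" by blast
  have tx: "?t (snd c x) = snd d x" using chart_inv_left[OF c x(1)] by simp
  then have xT: "?t (snd c x) \<in> ?T" using x by auto
  have cong: "frechet_derivative ((h \<circ> chart_inv d) \<circ> ?t) (at y) = frechet_derivative (h \<circ> chart_inv c) (at y)"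
    if "y \<in> ?S" for y
    by (rule frechet_derivative_cong_open[OF S that eq])
  show "frechet_derivative (h \<circ> chart_inv c) (at (snd c x)) u =
      frechet_derivative (h \<circ> chart_inv d) (at (snd d x)) (frechet_derivative ?t (at (snd c x)) u)"
    using smooth_on_chain[OF t xS h xT, of u] unfolding cong[OF xS] unfolding tx .
  have "frechet_derivative (\<lambda>y. frechet_derivative ((h \<circ> chart_inv d) \<circ> ?t) (at y) w) (at (snd c x))
      = frechet_derivative (\<lambda>y. frechet_derivative (h \<circ> chart_inv c) (at y) w) (at (snd c x))"
    by (rule frechet_derivative_cong_open[OF S xS]) (simp only: cong)
  then show "second_derivative (h \<circ> chart_inv c) (snd c x) u w =
      second_derivative (h \<circ> chart_inv d) (snd d x)
        (frechet_derivative ?t (at (snd c x)) u) (frechet_derivative ?t (at (snd c x)) w)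
      + frechet_derivative (h \<circ> chart_inv d) (at (snd d x)) (second_derivative ?t (snd c x) u w)"
    using second_derivative_compose[OF S xS img T h t, of u w]
    unfolding tx second_derivative_def by simp
qed

section \<open>Charts outside the atlas: smooth maps, tangent vectors, differentials\<close>

lemma C_diff_on_locally:
  assumes "\<And>x. x \<in> S \<Longrightarrow> \<exists>T. open T \<and> x \<in> T \<and> C_diff_on n T f"
  shows "C_diff_on n S f"
  using assms
proof (induction n arbitrary: f)
  case 0
  have "isCont f x" if "x \<in> S" for x
    using 0[OF that] continuous_on_eq_continuous_at by auto
  then show ?case by (auto intro: continuous_at_imp_continuous_on)
next
  case (Suc n)
  have "f differentiable (at x)" if "x \<in> S" for x
    using Suc.prems[OF that] by auto
  moreover have "C_diff_on n S (\<lambda>x. frechet_derivative f (at x) v)" for v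
  proof (rule Suc.IH)
    fix x assume "x \<in> S"
    then show "\<exists>T. open T \<and> x \<in> T \<and> C_diff_on n T (\<lambda>x. frechet_derivative f (at x) v)"
      using Suc.prems by fastforce
  qed
  ultimately show ?case by simp
qed

lemma smooth_on_locally:
  assumes "\<And>x. x \<in> S \<Longrightarrow> \<exists>T. open T \<and> x \<in> T \<and> smooth_on T f"
  shows "smooth_on S f"
  unfolding smooth_on_def
proof (intro allI C_diff_on_locally)
  fix n x assume "x \<in> S"
  then show "\<exists>T. open T \<and> x \<in> T \<and> C_diff_on n T f"
    using assms[of x] unfolding smooth_on_def by blast
qed

text \<open>These are the charts of the maximal atlas. Flat coordinates are of this kind and may lie
  outside \<open>A\<close>.\<close>

definition compatible_chart :: "'a topology \<Rightarrow> ('a, 'e::euclidean_space) chart set \<Rightarrow> ('a, 'e) chart \<Rightarrow> bool" where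
  "compatible_chart X A g \<longleftrightarrow>
     is_chart X g \<and> (\<forall>c\<in>A. smooth_transition c g \<and> smooth_transition g c)"

lemma
  assumes "smooth_manifold X A" "c \<in> charts_at A x"
  shows charts_at_is_chart: "is_chart X c" and charts_at_mem: "c \<in> A" "x \<in> fst c"
  using assms by (auto simp: smooth_manifold_def charts_at_def)

lemma charts_at_some:
  assumes "smooth_manifold X A" "x \<in> topspace X"
  shows "(SOME c. c \<in> charts_at A x) \<in> charts_at A x"
proof -
  have "x \<in> (\<Union>c\<in>A. fst c)" using assms by (simp add: smooth_manifold_def)
  then have "\<exists>c. c \<in> charts_at A x" unfolding charts_at_def by blast
  then show ?thesis by (rule someI_ex)
qed

text \<open>Around each point of the domain of \<open>g\<close> some chart of the atlas is
  available; smoothness is transferred from it and glued by locality.\<close>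

lemma smooth_map_in_chart:
  assumes "smooth_manifold X A" "compatible_chart X A g" "smooth_map A f"
  shows "smooth_on (snd g ` fst g) (f \<circ> chart_inv g)"
proof (rule smooth_on_locally)
  fix y assume "y \<in> snd g ` fst g"
  then obtain x where x: "x \<in> fst g" "y = snd g x" by blast
  have g: "is_chart X g" using assms(2) by (simp add: compatible_chart_def)
  have "x \<in> topspace X" using x(1) openin_subset[OF chart_openin[OF g]] by blast
  from charts_at_some[OF assms(1) this] obtain c where "c \<in> charts_at A x" by blast
  note c = charts_at_mem[OF assms(1) this] and cc = charts_at_is_chart[OF assms(1) this]
  have "smooth_on (snd c ` (fst c \<inter> fst c)) (f \<circ> chart_inv c)"
    using assms(3) c(1) by (simp add: smooth_map_def)
  from chart_change_smooth_on[OF g cc _ chart_openin[OF cc] this]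
  have "smooth_on (snd g ` (fst g \<inter> (fst c \<inter> fst c))) (f \<circ> chart_inv g)"
    using assms(2) c(1) by (simp add: compatible_chart_def)
  moreover have "open (snd g ` (fst g \<inter> (fst c \<inter> fst c)))"
    using open_chart_image[OF g chart_openin[OF cc]] by simp
  ultimately show "\<exists>T. open T \<and> y \<in> T \<and> smooth_on T (f \<circ> chart_inv g)" using x c(2) by blast
qed

lemma smooth_on_ident: "smooth_on S (\<lambda>x. x)"
  unfolding smooth_on_def
proof
  fix n show "C_diff_on n S (\<lambda>x. x)"
    by (cases n) (auto intro: continuous_on_id C_diff_on_const)
qed

lemma chart_in_itself:
  assumes "is_chart X g"
  shows "smooth_on (snd g ` fst g) (snd g \<circ> chart_inv g)"
    and "x \<in> fst g \<Longrightarrow> frechet_derivative (snd g \<circ> chart_inv g) (at (snd g x)) u = u"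
proof -
  have op: "open (snd g ` fst g)" using open_chart_image[OF assms chart_openin[OF assms]] by simp
  have eq: "(\<lambda>y. y) y = (snd g \<circ> chart_inv g) y" if "y \<in> snd g ` fst g" for y
    using that chart_inv_left[OF assms] by auto
  show "smooth_on (snd g ` fst g) (snd g \<circ> chart_inv g)"
    by (rule smooth_on_cong[OF op eq smooth_on_ident])
  show "frechet_derivative (snd g \<circ> chart_inv g) (at (snd g x)) u = u" if "x \<in> fst g"
  proof -
    have "frechet_derivative (\<lambda>y. y) (at (snd g x)) = frechet_derivative (snd g \<circ> chart_inv g) (at (snd g x))"
      by (rule frechet_derivative_cong_open[OF op imageI[OF that] eq])
    then show ?thesis by (metis frechet_derivative_ident)
  qed
qed

text \<open>A tangent vector stores coordinates in the charts of \<open>A\<close> only, so its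
  representation in \<open>g\<close> is expressed through a transition map. The vector is built by
  carrying \<open>u\<close> from \<open>g\<close> to every chart around \<open>x\<close>; the chain
  rule makes the family consistent.\<close>

lemma tangent_vector_of_representation:
  assumes A: "smooth_manifold X A" and g: "compatible_chart X A g" and x: "x \<in> fst g"
  shows "\<exists>v\<in>tangent_space A x. \<forall>c\<in>charts_at A x.
    frechet_derivative (snd g \<circ> chart_inv c) (at (snd c x)) (v c) = u"
proof -
  let ?D = "\<lambda>c. frechet_derivative (snd c \<circ> chart_inv g) (at (snd g x)) u"
  define v where "v = (\<lambda>c. if c \<in> charts_at A x then ?D c else 0)"
  have gc: "is_chart X g" using g by (simp add: compatible_chart_def)
  \<comment> \<open>Stated for arbitrary \<open>d\<close>: atlas charts give the transformation law,
    and \<open>d = g\<close> recovers \<open>u\<close>.\<close>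
  have change: "?D d = frechet_derivative (snd d \<circ> chart_inv c) (at (snd c x)) (?D c)"
    if "c \<in> charts_at A x" "is_chart X d" "x \<in> fst d" "smooth_transition c d" for c d
  proof -
    note c = charts_at_is_chart[OF A that(1)] charts_at_mem[OF A that(1)]
    have "smooth_on (snd c ` (fst c \<inter> fst d)) (snd d \<circ> chart_inv c)"
      using that(4) by (simp add: smooth_transition_def)
    from chart_change_frechet_derivative[OF gc c(1) _ chart_openin[OF that(2)] this x c(3) that(3)]
    show ?thesis using g c(2) by (simp add: compatible_chart_def)
  qed
  have "v \<in> tangent_space A x"
    unfolding tangent_space_def
  proof (rule CollectI, intro conjI allI impI ballI)
    show "v c = 0" if "c \<notin> charts_at A x" for c using that by (simp add: v_def)
    fix c d assume cd: "c \<in> charts_at A x" "d \<in> charts_at A x"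
    have "smooth_transition c d"
      using A charts_at_mem(1)[OF A cd(1)] charts_at_mem(1)[OF A cd(2)] by (simp add: smooth_manifold_def)
    from change[OF cd(1) charts_at_is_chart[OF A cd(2)] charts_at_mem(2)[OF A cd(2)] this]
    show "v d = frechet_derivative (snd d \<circ> chart_inv c) (at (snd c x)) (v c)"
      using cd by (simp add: v_def)
  qed
  moreover have "frechet_derivative (snd g \<circ> chart_inv c) (at (snd c x)) (v c) = u"
    if "c \<in> charts_at A x" for c
  proof -
    have "smooth_transition c g" using g charts_at_mem(1)[OF A that] by (simp add: compatible_chart_def)
    from change[OF that gc x this] show ?thesis
      using that chart_in_itself(2)[OF gc x, of u] by (simp add: v_def)
  qed
  ultimately show ?thesis by blast
qed

text \<open>\<open>differential\<close> is computed in an arbitrarily chosen chart of the atlas; the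
  chain rule moves the computation to \<open>g\<close>.\<close>

lemma differential_in_chart:
  assumes A: "smooth_manifold X A" and g: "compatible_chart X A g" and x: "x \<in> fst g"
    and f: "smooth_on (snd g ` fst g) (f \<circ> chart_inv g)"
  defines "c \<equiv> (SOME c. c \<in> charts_at A x)"
  shows "differential A f x v = frechet_derivative (f \<circ> chart_inv g) (at (snd g x))
     (frechet_derivative (snd g \<circ> chart_inv c) (at (snd c x)) (v c))"
proof -
  have gc: "is_chart X g" using g by (simp add: compatible_chart_def)
  have "x \<in> topspace X" using x openin_subset[OF chart_openin[OF gc]] by blast
  then have c: "c \<in> charts_at A x" unfolding c_def by (rule charts_at_some[OF A])
  note c' = charts_at_is_chart[OF A c] charts_at_mem[OF A c]
  have "smooth_on (snd g ` (fst g \<inter> fst g)) (f \<circ> chart_inv g)" using f by simp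
  from chart_change_frechet_derivative[OF c'(1) gc _ chart_openin[OF gc] this c'(3) x x]
  show ?thesis
    using g c'(2) unfolding differential_def c_def[symmetric] Let_def by (simp add: compatible_chart_def)
qed

section \<open>Second-order flatness in flat coordinates\<close>

lemma differentiable_locally_lipschitz_at:
  fixes f :: "'a::real_normed_vector \<Rightarrow> 'b::real_normed_vector"
  assumes "f differentiable (at x)"
  obtains C where "C > 0" "\<forall>\<^sub>F y in at x. dist (f y) (f x) \<le> C * dist y x"
proof -
  obtain D where D: "(f has_derivative D) (at x)" using assms by (auto simp: differentiable_def)
  obtain K where K: "K > 0" "\<And>h. norm (D h) \<le> norm h * K"
    using bounded_linear.pos_bounded[OF has_derivative_bounded_linear[OF D]] by blast
  obtain d where d: "d > 0" "\<And>y. norm (y - x) < d \<Longrightarrow> norm (f y - f x - D (y - x)) \<le> 1 * norm (y - x)"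
    using D unfolding has_derivative_at_alt by (metis zero_less_one)
  show thesis
  proof
    show "K + 1 > 0" using K(1) by simp
    show "\<forall>\<^sub>F y in at x. dist (f y) (f x) \<le> (K + 1) * dist y x"
      unfolding eventually_at
    proof (intro exI[of _ d] conjI d(1) ballI impI)
      fix y assume "y \<noteq> x \<and> dist y x < d"
      then have "norm (f y - f x - D (y - x)) \<le> norm (y - x)" using d(2)[of y] by (simp add: dist_norm)
      then have "norm (f y - f x) \<le> norm (y - x) + norm (D (y - x))"
        using norm_triangle_ineq[of "f y - f x - D (y - x)" "D (y - x)"] by simp
      then show "dist (f y) (f x) \<le> (K + 1) * dist y x"
        using K(2)[of "y - x"] by (simp add: dist_norm algebra_simps)
    qed
  qed
qed

text \<open>A chart is open and injective, so it carries punctured neighbourhoods of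
  \<open>p\<close> to punctured neighbourhoods of its image.\<close>

lemma eventually_atin_chart:
  assumes g: "is_chart X g" and p: "p \<in> fst g" and P: "\<forall>\<^sub>F x in atin X p. P x"
  shows "\<forall>\<^sub>F y in at (snd g p). y \<in> snd g ` fst g \<and> P (chart_inv g y)"
proof -
  have "p \<in> topspace X" using p openin_subset[OF chart_openin[OF g]] by blast
  then obtain W where W: "openin X W" "p \<in> W" "\<And>x. x \<in> W \<Longrightarrow> x \<noteq> p \<Longrightarrow> P x"
    using P unfolding eventually_atin by blast
  have "open (snd g ` (fst g \<inter> W))" by (rule open_chart_image[OF g W(1)])
  moreover have "snd g p \<in> snd g ` (fst g \<inter> W)" using p W(2) by blast
  ultimately have "\<forall>\<^sub>F y in at (snd g p). y \<in> snd g ` (fst g \<inter> W) \<and> y \<noteq> snd g p"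
    using eventually_at_topological by blast
  then show ?thesis
  proof eventually_elim
    case (elim y)
    then obtain x where x: "x \<in> fst g" "x \<in> W" "y = snd g x" by blast
    then have "x \<noteq> p" using elim by blast
    then show ?case using x W(3) chart_inv_left[OF g x(1)] by auto
  qed
qed

text \<open>Take at each nearby point the tangent vector with constant flat coordinates
  \<open>u\<close>. The flat metric gives it the constant length \<open>N u\<close>, while the
  isometry \<open>f\<close> gives it the length in \<open>\<Phi>\<close> of the derivative of
  \<open>f\<close> read in \<open>g\<close>.\<close>

lemma flat_chart_second_order_isometric:
  fixes f :: "'a \<Rightarrow> 'v::euclidean_space" and g :: "('a, 'e::euclidean_space) chart"
  assumes A: "smooth_manifold M A" and g: "compatible_chart M A g" and p: "p \<in> fst g"
    and f: "smooth_map A f" and N: "banach_minkowski_norm N"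
    and iso: "isometric_on A (topspace M) \<phi> f \<Phi>" and flat: "isometric_on A (fst g) \<phi>0 (snd g) N"
    and c: "c \<in> charts_at A p"
    and near: "\<And>e. e > 0 \<Longrightarrow> \<forall>\<^sub>F x in atin M p. \<forall>v\<in>tangent_space A x - {zero_tangent}.
      \<bar>\<phi> x v / \<phi>0 x v - 1\<bar> \<le> e * (dist (snd c x) (snd c p))\<^sup>2"
    and "e > 0" "u \<noteq> 0"
  shows "\<forall>\<^sub>F y in at (snd g p).
      \<bar>\<Phi> (frechet_derivative (f \<circ> chart_inv g) (at y) u) / N u - 1\<bar> \<le> e * (dist y (snd g p))\<^sup>2"
proof -
  have gc: "is_chart M g" using g by (simp add: compatible_chart_def)
  note c' = charts_at_is_chart[OF A c] charts_at_mem[OF A c]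
  have "smooth_on (snd g ` (fst g \<inter> fst c)) (snd c \<circ> chart_inv g)"
    using g c'(2) by (simp add: compatible_chart_def smooth_transition_def)
  moreover have "snd g p \<in> snd g ` (fst g \<inter> fst c)" using p c'(3) by blast
  ultimately have "(snd c \<circ> chart_inv g) differentiable (at (snd g p))"
    by (rule smooth_on_differentiable)
  then obtain C where C: "C > 0"
    "\<forall>\<^sub>F y in at (snd g p). dist ((snd c \<circ> chart_inv g) y) ((snd c \<circ> chart_inv g) (snd g p)) \<le> C * dist y (snd g p)"
    by (rule differentiable_locally_lipschitz_at)
  \<comment> \<open>The hypothesis measures distance in the chart \<open>c\<close>, the conclusion
    in \<open>g\<close>; the Lipschitz constant of the transition enters squared.\<close>
  have "e / C\<^sup>2 > 0" using \<open>e > 0\<close> C(1) by simp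
  from C(2) eventually_atin_chart[OF gc p near[OF this]] show ?thesis
  proof eventually_elim
    case (elim y)
    then obtain x where x: "x \<in> fst g" "y = snd g x" by blast
    have inv: "chart_inv g y = x" "chart_inv g (snd g p) = p"
      using chart_inv_left[OF gc] x p by auto
    have xM: "x \<in> topspace M" using x(1) openin_subset[OF chart_openin[OF gc]] by blast
    obtain v where v: "v \<in> tangent_space A x"
      "\<And>c. c \<in> charts_at A x \<Longrightarrow> frechet_derivative (snd g \<circ> chart_inv c) (at (snd c x)) (v c) = u"
      using tangent_vector_of_representation[OF A g x(1), of u] by blast
    note some = charts_at_some[OF A xM]
    have df: "differential A f x v = frechet_derivative (f \<circ> chart_inv g) (at y) u"
      using differential_in_chart[OF A g x(1) smooth_map_in_chart[OF A g f], of v] v(2)[OF some] x(2) by simp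
    have dg: "differential A (snd g) x v = u"
      using differential_in_chart[OF A g x(1) chart_in_itself(1)[OF gc], of v] v(2)[OF some]
        chart_in_itself(2)[OF gc x(1)] by simp
    have vals: "\<phi> x v = \<Phi> (frechet_derivative (f \<circ> chart_inv g) (at y) u)" "\<phi>0 x v = N u"
      using iso flat xM x(1) v(1) df dg unfolding isometric_on_def by metis+
    have "v \<noteq> zero_tangent"
    proof
      assume "v = zero_tangent"
      let ?c = "SOME c. c \<in> charts_at A x"
      note d = charts_at_mem[OF A some]
      have "smooth_on (snd ?c ` (fst ?c \<inter> fst g)) (snd g \<circ> chart_inv ?c)"
        using g d(1) by (simp add: compatible_chart_def smooth_transition_def)
      then have "linear (frechet_derivative (snd g \<circ> chart_inv ?c) (at (snd ?c x)))"
        by (rule smooth_on_linear_frechet) (use d(2) x(1) in blast)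
      then show False using v(2)[OF some] \<open>v = zero_tangent\<close> \<open>u \<noteq> 0\<close> linear_0 by fastforce
    qed
    then have "\<bar>\<phi> x v / \<phi>0 x v - 1\<bar> \<le> e / C\<^sup>2 * (dist (snd c x) (snd c p))\<^sup>2"
      using elim v(1) unfolding inv by blast
    also have "\<dots> \<le> e / C\<^sup>2 * (C * dist y (snd g p))\<^sup>2"
      using elim(1) \<open>e / C\<^sup>2 > 0\<close> by (intro mult_left_mono power_mono) (auto simp: inv)
    also have "\<dots> = e * (dist y (snd g p))\<^sup>2" using C(1) by (simp add: power_mult_distrib)
    finally show ?case unfolding vals .
  qed
qed

lemma zero_tangent_in_tangent_space:
  assumes "smooth_manifold M A"
  shows "zero_tangent \<in> tangent_space A x"
  unfolding tangent_space_def
proof (rule CollectI, intro conjI allI impI ballI)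
  fix c d assume cd: "c \<in> charts_at A x" "d \<in> charts_at A x"
  note m = charts_at_mem[OF assms cd(1)] charts_at_mem[OF assms cd(2)]
  have "smooth_on (snd c ` (fst c \<inter> fst d)) (snd d \<circ> chart_inv c)"
    using assms m by (simp add: smooth_manifold_def smooth_transition_def)
  then have "linear (frechet_derivative (snd d \<circ> chart_inv c) (at (snd c x)))"
    by (rule smooth_on_linear_frechet) (use m in blast)
  then show "0 = frechet_derivative (snd d \<circ> chart_inv c) (at (snd c x)) 0" by (simp add: linear_0)
qed simp

section \<open>Degeneracy of the second fundamental form\<close>

theorem theorem3:
  fixes M :: "'a topology"
    and A :: "('a, real^2) chart set"
    and \<phi> :: "'a \<Rightarrow> ('a, real^2) tangent_vector \<Rightarrow> real"
    and p :: 'a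
    and \<Phi> :: "'v::euclidean_space \<Rightarrow> real"
    and f :: "'a \<Rightarrow> 'v"
    and \<pi> :: "'v \<Rightarrow> real"
  assumes "smooth_manifold M A"
    and "finsler_metric_on M A (topspace M) \<phi>"
    and "p \<in> topspace M"
    and "second_order_flat_at M A \<phi> p"
    and "DIM('v) = 3"
    and "banach_minkowski_norm \<Phi>"
    and "smooth_embedding M A f"
    and "isometric_on A (topspace M) \<phi> f \<Phi>"
    and "quotient_projection (differential A f p ` tangent_space A p) \<pi>"
  shows "degenerate_form (tangent_space A p) (second_fundamental_form A f \<pi> p)"
proof -
  note M = assms(1) and \<Phi> = assms(6)
  obtain U \<phi>0 c0 where U: "p \<in> U" "flat_metric_on M A U \<phi>0" "c0 \<in> charts_at A p"
    and near: "\<And>e. e > 0 \<Longrightarrow> \<forall>\<^sub>F x in atin M p. \<forall>v\<in>tangent_space A x - {zero_tangent}.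
      \<bar>\<phi> x v / \<phi>0 x v - 1\<bar> \<le> e * (dist (snd c0 x) (snd c0 p))\<^sup>2"
    using assms(4) unfolding second_order_flat_at_def by blast
  obtain g N where g: "compatible_chart M A g" and p: "p \<in> fst g"
    and N: "banach_minkowski_norm N" and flat: "isometric_on A (fst g) \<phi>0 (snd g) N"
    using U(1,2) unfolding flat_metric_on_def compatible_chart_def by blast
  have gc: "is_chart M g" using g by (simp add: compatible_chart_def)
  have f: "smooth_map A f" using assms(7) by (simp add: smooth_embedding_def)
  define H where "H = f \<circ> chart_inv g"
  define y0 where "y0 = snd g p"
  define S where "S = snd g ` fst g"
  \<comment> \<open>The very chart chosen inside \<open>differential\<close> and
    \<open>hessian_at\<close>; \<open>\<tau>\<close> takes its coordinates to flat ones.\<close>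
  define c where "c = (SOME c. c \<in> charts_at A p)"
  define \<tau> where "\<tau> = frechet_derivative (snd g \<circ> chart_inv c) (at (snd c p))"
  have S: "open S" "y0 \<in> S" using open_chart_image[OF gc chart_openin[OF gc]] p by (auto simp: S_def y0_def)
  have H: "smooth_on S H" unfolding S_def H_def by (rule smooth_map_in_chart[OF M g f])
  have c: "c \<in> charts_at A p" unfolding c_def by (rule charts_at_some[OF M assms(3)])
  note c' = charts_at_is_chart[OF M c] charts_at_mem[OF M c]
  define L where "L = frechet_derivative H (at y0)"
  define B where "B = second_derivative H y0"
  define T where "T = (\<lambda>v. second_derivative (\<lambda>y. frechet_derivative H (at y) v) y0)"
  define \<Psi> where "\<Psi> = (\<lambda>x. (\<Phi> x)\<^sup>2)"
  have dL: "differential A f p v = L (\<tau> (v c))" for v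
    using differential_in_chart[OF M g p smooth_map_in_chart[OF M g f], of v]
    unfolding L_def H_def y0_def \<tau>_def c_def .
  have lift: "\<exists>v\<in>tangent_space A p. \<tau> (v c) = u" for u
    using tangent_vector_of_representation[OF M g p, of u] c unfolding \<tau>_def by blast
  have "smooth_on (snd c ` (fst c \<inter> fst g)) (snd g \<circ> chart_inv c)"
    using g c'(2) by (simp add: compatible_chart_def smooth_transition_def)
  then have lin_\<tau>: "linear \<tau>"
    unfolding \<tau>_def by (rule smooth_on_linear_frechet) (use c' p in blast)
  have lin_L: "linear L" unfolding L_def by (rule smooth_on_linear_frechet[OF H S(2)])
  \<comment> \<open>The differential of an embedding is injective on the tangent space, and
    \<open>lift\<close> realizes every flat coordinate vector.\<close>
  have L_nz: "L u \<noteq> 0" if "u \<noteq> 0" for u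
  proof
    assume "L u = 0"
    obtain v where v: "v \<in> tangent_space A p" "\<tau> (v c) = u" using lift by blast
    have "differential A f p v = differential A f p zero_tangent"
      unfolding dL v(2) \<open>L u = 0\<close> using linear_0[OF lin_\<tau>] linear_0[OF lin_L] by simp
    moreover have "inj_on (differential A f p) (tangent_space A p)"
      using assms(3,7) by (simp add: smooth_embedding_def)
    ultimately have "v = zero_tangent"
      using v(1) zero_tangent_in_tangent_space[OF M] by (simp add: inj_on_eq_iff)
    then show False using v(2) linear_0[OF lin_\<tau>] that by simp
  qed
  have \<pi>: "linear \<pi>" "{w. \<pi> w = 0} = differential A f p ` tangent_space A p"
    using assms(9) by (auto simp: quotient_projection_def)
  have "range L = differential A f p ` tangent_space A p"
  proof (rule set_eqI, rule iffI)
    fix x assume "x \<in> range L"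
    then obtain u where "x = L u" by blast
    moreover obtain v where "v \<in> tangent_space A p" "\<tau> (v c) = u" using lift by blast
    ultimately show "x \<in> differential A f p ` tangent_space A p" by (intro image_eqI) (auto simp: dL)
  qed (auto simp: dL)
  then have range_L: "range L = {x. \<pi> x = 0}" using \<pi>(2) by simp
  have N_pos: "N u > 0" if "u \<noteq> 0" for u
    using N that by (simp add: banach_minkowski_norm_def minkowski_norm_def)
  have small: "\<forall>\<^sub>F y in at y0. \<bar>\<Phi> (frechet_derivative H (at y) u) / N u - 1\<bar> \<le> e * (dist y y0)\<^sup>2"
    if "u \<noteq> 0" "e > 0" for u e
    unfolding H_def y0_def
    by (rule flat_chart_second_order_isometric[OF M g p f N assms(8) flat U(3) near that(2,1)])
  note \<Psi> = smooth_on_power2_minkowski[OF \<Phi>, folded \<Psi>_def]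
  have op: "open (UNIV - {0::'v})" by (simp add: open_delete)
  have LU: "L v \<in> UNIV - {0}" if "v \<noteq> 0" for v using L_nz[OF that] by simp
  note D = smooth_on_frechet_derivative[OF H]
  have "\<exists>u. u \<noteq> 0 \<and> (\<forall>w. \<pi> (B u w) = 0)"
  proof (rule normal_form_degenerate[where L = L and T = T and \<nu> = "\<lambda>v. frechet_derivative \<Psi> (at (L v))"
      and q = "\<lambda>v. second_derivative \<Psi> (L v)"])
    show "DIM(real^2) = 2" by simp
    show "linear (B v)" for v
      unfolding B_def by (rule linear_second_derivative_right[OF S(1) H S(2)])
    show "B u v = B v u" for u v
      unfolding B_def by (rule second_derivative_commute[OF S(1) H S(2)])
    show "linear (T v w)" for v w
      unfolding T_def by (rule linear_second_derivative_right[OF S(1) D S(2)])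
    show T23: "T u v w = T u w v" for u v w
      unfolding T_def by (rule second_derivative_commute[OF S(1) D S(2)])
    \<comment> \<open>The slots \<open>u\<close> and \<open>w\<close> are the two directions of the
      Hessian of \<open>H\<close>, symmetric at every point of \<open>S\<close>, and
      \<open>v\<close> is the outermost direction. Together with \<open>T23\<close> this gives the
      full symmetry of \<open>T\<close>.\<close>
    have T13: "T u v w = T w v u" for u v w
    proof -
      have "frechet_derivative (\<lambda>y. second_derivative H y w u) (at y0)
          = frechet_derivative (\<lambda>y. second_derivative H y u w) (at y0)"
        by (rule frechet_derivative_cong_open[OF S]) (rule second_derivative_commute[OF S(1) H])
      then show ?thesis unfolding T_def second_derivative_def by simp
    qed
    show "T u v w = T v u w" for u v w using T23 T13 by metis
    show "linear (frechet_derivative \<Psi> (at (L v)))" if "v \<noteq> 0" for v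
      by (rule smooth_on_linear_frechet[OF \<Psi> LU[OF that]])
    show "continuous_on (UNIV - {0}) (\<lambda>v. frechet_derivative \<Psi> (at (L v)) \<xi>)" for \<xi>
      by (rule continuous_on_compose2[OF smooth_on_continuous_on[OF smooth_on_frechet_derivative[OF \<Psi>]]
            linear_continuous_on[OF linear_linear[THEN iffD2, OF lin_L]]]) (use LU in auto)
    show "frechet_derivative \<Psi> (at (L v)) (L v) > 0" if "v \<noteq> 0" for v
    proof -
      have "\<Phi> (L v) > 0" using \<Phi> L_nz[OF that] by (simp add: banach_minkowski_norm_def minkowski_norm_def)
      then show ?thesis using minkowski_euler[OF \<Phi> L_nz[OF that]] by (simp add: \<Psi>_def)
    qed
    show "frechet_derivative \<Psi> (at (L v)) (B v w) = 0" if "v \<noteq> 0" for v w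
      unfolding \<Psi>_def L_def B_def
      by (rule first_order_isometric[OF S(1) H S(2) \<Phi> N_pos[OF that] L_nz[OF that, unfolded L_def] small[OF that]])
    show "second_derivative \<Psi> (L v) (B v w) (B v u) + frechet_derivative \<Psi> (at (L v)) (T v w u) = 0"
      if "v \<noteq> 0" for v w u
      unfolding \<Psi>_def L_def B_def T_def
      by (rule second_order_isometric[OF S(1) H S(2) \<Phi> N_pos[OF that] L_nz[OF that, unfolded L_def] small[OF that]])
    show "second_derivative \<Psi> (L v) 0 x = 0" if "v \<noteq> 0" for v x
      using linear_0[OF linear_second_derivative_left[OF \<Psi> LU[OF that], of x]] .
    show "second_derivative \<Psi> (L v) x x > 0" if "v \<noteq> 0" "x \<noteq> 0" for v x
      using \<Phi> L_nz[OF that(1)] that(2) unfolding banach_minkowski_norm_def \<Psi>_def by blast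
  qed (use lin_L \<pi>(1) range_L in auto)
  then obtain u where u: "u \<noteq> 0" "\<And>w. \<pi> (B u w) = 0" by blast
  have bl: "bounded_linear \<pi>" using \<pi>(1) by (simp add: linear_linear)
  have \<pi>H: "smooth_on (snd g ` (fst g \<inter> fst g)) ((\<pi> \<circ> f) \<circ> chart_inv g)"
    using smooth_on_bounded_linear[OF S(1) bl H] by (simp add: S_def H_def comp_def)
  \<comment> \<open>Since \<open>\<pi>\<close> kills the tangent plane, the term with the second
    derivative of the transition map disappears. The Hessian is then a tensor and its kernel can be
    found in flat coordinates.\<close>
  have "frechet_derivative (\<pi> \<circ> H) (at y0) w = 0" for w
  proof -
    have "frechet_derivative (\<pi> \<circ> H) (at y0) w = \<pi> (L w)"
      using fun_cong[OF frechet_derivative_at[OF bounded_linear.has_derivative[OF bl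
          smooth_on_has_derivative[OF H S(2)]]], of w] by (simp add: comp_def L_def)
    moreover have "L w \<in> {x. \<pi> x = 0}" unfolding range_L[symmetric] by (rule rangeI)
    ultimately show ?thesis by simp
  qed
  moreover have "second_derivative (\<pi> \<circ> H) y0 u w = \<pi> (B u w)" for u w
    unfolding B_def by (rule second_derivative_bounded_linear[OF S(1) H S(2) bl])
  moreover have "smooth_transition c g" using g c'(2) by (simp add: compatible_chart_def)
  ultimately have "second_derivative ((\<pi> \<circ> f) \<circ> chart_inv c) (snd c p) a b = \<pi> (B (\<tau> a) (\<tau> b))" for a b
    using chart_change_second_derivative[OF c'(1) gc _ chart_openin[OF gc] \<pi>H c'(3) p p, of a b]
    unfolding \<tau>_def by (simp add: H_def y0_def comp_assoc)
  then have sff: "second_fundamental_form A f \<pi> p v w = \<pi> (B (\<tau> (v c)) (\<tau> (w c)))" for v w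
    unfolding second_fundamental_form_def hessian_at_def Let_def c_def[symmetric] .
  obtain v where v: "v \<in> tangent_space A p" "\<tau> (v c) = u" using lift by blast
  then have "v \<noteq> zero_tangent" using u(1) linear_0[OF lin_\<tau>] by auto
  with v u(2) sff show ?thesis unfolding degenerate_form_def by auto
qed

end
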